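(* There exists an absolute constant $C>0$ such that the following holds for all integers $d\ge 1$, $s\in\{1,\dots,d\}$, all $\sigma>0$, every $\boldsymbol{\theta}\in B_0(s,d)$ and every covariance matrix $\boldsymbol{\Sigma}$ satisfying Assumption $(\varepsilon^*0)$: \[ \mathbf{E}_{\boldsymbol\theta,\boldsymbol\Sigma}[(\hat Q-\|\boldsymbol\theta\|_2^2)^2]\le C\left(\sigma^2\|\boldsymbol\theta\|_2^2\,\lambda_{\max}(\boldsymbol\Sigma_{\mathcal S,\mathcal S})+\sigma^4\psi^2(s,\boldsymbol\Sigma)\right), \] where $\mathcal S=\{i:\theta_i\neq 0\}$ is the support of $\boldsymbol\theta$. Furthermore, for every $r>0$ and every $\boldsymbol\Sigma$ satisfying Assumption $(\varepsilon^*0)$, \[ \sup_{\boldsymbol\theta\in B_0(s,d)\cap B_2(r)}\mathbf{E}_{\boldsymbol\theta,\boldsymbol\Sigma}[(\hat Q-\|\boldsymbol\theta\|_2^2)^2]\le C\left(\sigma^2 r^2\bar\psi(s,\boldsymbol\Sigma)+\sigma^4\psi^2(s,\boldsymbol\Sigma)\right) \] and \[ \sup_{\boldsymbol\theta\in B_0(s,d)}\mathbf{E}_{\boldsymbol\theta,\boldsymbol\Sigma}[(\hat N-\|\boldsymbol\theta\|_2)^2]\le C\sigma^2\psi(s,\boldsymbol\Sigma). \]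
   Context: Model: one observes $\boldsymbol Y=(Y_1,\dots,Y_d)=\boldsymbol\theta+\sigma\boldsymbol\varepsilon$, where $\boldsymbol\theta\in\mathbb R^d$ is unknown, $\boldsymbol\varepsilon\sim\mathcal N(\boldsymbol 0,\boldsymbol\Sigma)$ with $\boldsymbol\Sigma$ a $d\times d$ covariance matrix, and the noise level $\sigma>0$ is known. $\mathbf P_{\boldsymbol\theta,\boldsymbol\Sigma}$, $\mathbf E_{\boldsymbol\theta,\boldsymbol\Sigma}$ denote probability and expectation under this model. The diagonal entries $\sigma_i^2=\boldsymbol\Sigma_{ii}$ are known; the off-diagonal entries are not used. $B_0(s,d)=\{\boldsymbol\theta\in\mathbb R^d:\|\boldsymbol\theta\|_0\le s\}$ ($\|\cdot\|_0$ = number of nonzero entries), $B_2(r)=\{x\in\mathbb R^d:\|x\|_2\le r\}$. Assumption $(\varepsilon^*0)$: $\max_{1\le i\le d}\sigma_i^2\le 1$. $\|\boldsymbol\Sigma\|_F$ is the Frobenius norm, $\lambda_{\max}$ the largest eigenvalue, $\boldsymbol\Sigma_{\mathcal S,\mathcal S}$ the principal submatrix with rows and columns in $\mathcal S$. Let $\tau=3\sqrt{\log(1+\|\boldsymbol\Sigma\|_F^2/s^2)}$ and $\beta_s=\mathbf E[Z^2\mid |Z|\ge\tau]$ for $Z\sim\mathcal N(0,1)$. The estimator is \[ \hat Q=\begin{cases}\sum_{i=1}^d(Y_i^2-\sigma^2\sigma_i^2\beta_s)\mathbb 1\{|Y_i|>\sigma\sigma_i\tau\}, & s\le\|\boldsymbol\Sigma\|_F,\\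 \sum_{i=1}^d(Y_i^2-\sigma^2\sigma_i^2), &\text{otherwise},\end{cases}\qquad \hat N=\sqrt{|\hat Q|}. \] Rates: $\psi(s,\boldsymbol\Sigma)=s\log(1+\|\boldsymbol\Sigma\|_F^2/s^2)$ if $s\le\|\boldsymbol\Sigma\|_F$ and $\psi(s,\boldsymbol\Sigma)=\|\boldsymbol\Sigma\|_F$ otherwise; $\bar\psi(s,\boldsymbol\Sigma)=\lambda_{\max}(\boldsymbol\Sigma)\wedge s$. *)

theory Defs
  imports "HOL-Probability.Probability"
begin

text \<open>Vectors in R^d are functions nat => real, only indices i < d matter;
  d x d matrices are functions nat => nat => real, only indices < d matter.\<close>

definition l0 :: "nat \<Rightarrow> (nat \<Rightarrow> real) \<Rightarrow> nat" where
  "l0 d \<theta> = card {i. i < d \<and> \<theta> i \<noteq> 0}"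

definition sqnorm :: "nat \<Rightarrow> (nat \<Rightarrow> real) \<Rightarrow> real" where
  "sqnorm d \<theta> = (\<Sum>i<d. (\<theta> i)\<^sup>2)"

definition frob :: "nat \<Rightarrow> (nat \<Rightarrow> nat \<Rightarrow> real) \<Rightarrow> real" where
  "frob d M = sqrt (\<Sum>i<d. \<Sum>j<d. (M i j)\<^sup>2)"

definition is_eigenvalue_on :: "nat set \<Rightarrow> (nat \<Rightarrow> nat \<Rightarrow> real) \<Rightarrow> real \<Rightarrow> bool" where
  "is_eigenvalue_on S M k \<longleftrightarrow> (\<exists>x::nat \<Rightarrow> real. (\<exists>i\<in>S. x i \<noteq> 0) \<and>
      (\<forall>i\<in>S. (\<Sum>j\<in>S. M i j * x j) = k * x i))"

definition lambda_max :: "nat set \<Rightarrow> (nat \<Rightarrow> nat \<Rightarrow> real) \<Rightarrow> real" where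
  "lambda_max S M = Max {k. is_eigenvalue_on S M k}"

definition psi :: "nat \<Rightarrow> nat \<Rightarrow> (nat \<Rightarrow> nat \<Rightarrow> real) \<Rightarrow> real" where
  "psi d s M = (if real s \<le> frob d M then real s * ln (1 + (frob d M)\<^sup>2 / (real s)\<^sup>2)
                else frob d M)"

definition psibar :: "nat \<Rightarrow> nat \<Rightarrow> (nat \<Rightarrow> nat \<Rightarrow> real) \<Rightarrow> real" where
  "psibar d s M = min (lambda_max {..<d} M) (real s)"

definition tau :: "nat \<Rightarrow> nat \<Rightarrow> (nat \<Rightarrow> nat \<Rightarrow> real) \<Rightarrow> real" where
  "tau d s M = 3 * sqrt (ln (1 + (frob d M)\<^sup>2 / (real s)\<^sup>2))"

definition cond_second_moment :: "real \<Rightarrow> real" where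
  "cond_second_moment t =
     (\<integral>z. (if t \<le> \<bar>z\<bar> then z\<^sup>2 * std_normal_density z else 0) \<partial>lborel) /
     (\<integral>z. (if t \<le> \<bar>z\<bar> then std_normal_density z else 0) \<partial>lborel)"

definition Qhat :: "nat \<Rightarrow> nat \<Rightarrow> real \<Rightarrow> (nat \<Rightarrow> nat \<Rightarrow> real) \<Rightarrow> (nat \<Rightarrow> real) \<Rightarrow> real" where
  "Qhat d s \<sigma> M Y =
    (if real s \<le> frob d M then
       (\<Sum>i<d. (if \<bar>Y i\<bar> > \<sigma> * sqrt (M i i) * tau d s M
               then (Y i)\<^sup>2 - \<sigma>\<^sup>2 * M i i * cond_second_moment (tau d s M) else 0))
     else (\<Sum>i<d. (Y i)\<^sup>2 - \<sigma>\<^sup>2 * M i i))"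

definition Nhat :: "nat \<Rightarrow> nat \<Rightarrow> real \<Rightarrow> (nat \<Rightarrow> nat \<Rightarrow> real) \<Rightarrow> (nat \<Rightarrow> real) \<Rightarrow> real" where
  "Nhat d s \<sigma> M Y = sqrt \<bar>Qhat d s \<sigma> M Y\<bar>"

definition std_gauss_vec :: "nat \<Rightarrow> (nat \<Rightarrow> real) measure" where
  "std_gauss_vec d = PiM {..<d} (\<lambda>_. density lborel std_normal_density)"

text \<open>E_{theta,Sigma}[f(Y)] where Y = theta + sigma * A Z and Sigma = A A^T
  (so eps = A Z ~ N(0, Sigma)).\<close>
definition gauss_expect :: "nat \<Rightarrow> (nat \<Rightarrow> real) \<Rightarrow> real \<Rightarrow> (nat \<Rightarrow> nat \<Rightarrow> real)
     \<Rightarrow> ((nat \<Rightarrow> real) \<Rightarrow> real) \<Rightarrow> real" where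
  "gauss_expect d \<theta> \<sigma> A f =
     (\<integral>z. f (\<lambda>i. \<theta> i + \<sigma> * (\<Sum>k<d. A i k * z k)) \<partial>std_gauss_vec d)"

definition gram :: "nat \<Rightarrow> (nat \<Rightarrow> nat \<Rightarrow> real) \<Rightarrow> (nat \<Rightarrow> nat \<Rightarrow> real)" where
  "gram d A = (\<lambda>i j. \<Sum>k<d. A i k * A j k)"

end

theory Submission
  imports Defs
begin

text \<open>
  Write \<open>\<epsilon> = A z\<close> and split \<open>Q - |\<theta>|\<^sup>2\<close> into the linear term \<open>2 \<sigma> \<langle>\<theta>, \<epsilon>\<rangle>\<close>, a remainder
  living on the support of \<open>\<theta>\<close> and bounded deterministically by
  \<open>\<sigma>\<^sup>2 \<Sum>\<^sub>S (\<epsilon>\<^sub>i\<^sup>2 + \<beta> + \<tau>\<^sup>2)\<close>, and a pure noise term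
  \<open>\<sigma>\<^sup>2 \<Sum> \<sigma>\<^sub>i\<^sup>2 f (\<epsilon>\<^sub>i / \<sigma>\<^sub>i)\<close> off the support, with \<open>f\<close> even and centred by the choice of \<open>\<beta>\<close>
  (in the dense regime \<open>f x = x\<^sup>2 - 1\<close>, summed over all coordinates).

  For such \<open>f\<close> the covariance of \<open>f X\<close> and \<open>f Y\<close>, with \<open>X, Y\<close> standard normal of correlation
  \<open>\<rho>\<close>, is \<open>O(\<rho>\<^sup>2)\<close>: relative to the product law, the joint density is \<open>1 + \<rho> x y + O(\<rho>\<^sup>2)\<close>
  up to a factor \<open>exp ((x\<^sup>2 + y\<^sup>2) / 8)\<close>, and the first two terms integrate to \<open>0\<close> against
  \<open>f x f y\<close>. Summing over pairs turns \<open>\<rho>\<^sub>i\<^sub>j\<^sup>2 \<sigma>\<^sub>i\<^sup>2 \<sigma>\<^sub>j\<^sup>2\<close> into the squared Frobenius norm,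
  and the threshold contributes the factor \<open>exp (- \<tau>\<^sup>2 / 9)\<close>, which is at most the ratio of
  \<open>s\<^sup>2\<close> to the squared Frobenius norm.

  All bounds are first obtained with the quadratic form \<open>\<theta>\<^sup>T \<Sigma> \<theta>\<close>, which is at most
  \<open>|\<theta>|\<^sup>2\<close> times each of \<open>\<lambda>\<^sub>m\<^sub>a\<^sub>x\<close>, \<open>s\<close> and the Frobenius norm. The norm estimator is reduced
  to \<open>Q\<close> by comparing \<open>(\<surd>|Q| - \<surd>q)\<^sup>2\<close> with both \<open>|Q - q|\<close> and \<open>(Q - q)\<^sup>2 / q\<close>.
\<close>

section \<open>Joint law of two linear forms in a Gaussian vector\<close>

abbreviation std_gauss :: "real measure" where
  "std_gauss \<equiv> density lborel std_normal_density"

lemma prob_space_std_gauss: "prob_space std_gauss"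
  by (rule prob_space_normal_density) simp

interpretation std_gauss: prob_space std_gauss
  by (rule prob_space_std_gauss)

interpretation std_gauss2: pair_prob_space std_gauss std_gauss
  by unfold_locales

lemma nn_integral_std_gauss:
  "f \<in> borel_measurable borel \<Longrightarrow>
    (\<integral>\<^sup>+x. f x \<partial>std_gauss) = (\<integral>\<^sup>+x. ennreal (std_normal_density x) * f x \<partial>lborel)"
  by (subst nn_integral_density) auto

lemma std_normal_density_rotate:
  fixes c s w t :: real
  assumes "c\<^sup>2 + s\<^sup>2 = 1"
  shows "std_normal_density (c * w - s * t) * std_normal_density (s * w + c * t)
       = std_normal_density w * std_normal_density t"
proof -
  have "(c * w - s * t)\<^sup>2 + (s * w + c * t)\<^sup>2 = (c\<^sup>2 + s\<^sup>2) * (w\<^sup>2 + t\<^sup>2)"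
    by (simp add: power2_eq_square algebra_simps)
  then have "(c * w - s * t)\<^sup>2 + (s * w + c * t)\<^sup>2 = w\<^sup>2 + t\<^sup>2"
    using assms by simp
  then show ?thesis
    by (simp add: normal_density_def exp_add[symmetric] add_divide_distrib[symmetric])
qed

text \<open>Rotation invariance of the planar Gaussian law, reduced to two one-dimensional affine
  substitutions joined by Fubini: \<open>w = c u + s v\<close> for fixed \<open>u\<close>, then
  \<open>u = c w - s t\<close> for fixed \<open>w\<close>. The Jacobians \<open>1 / |s|\<close> and
  \<open>|s|\<close> cancel, and the density product is invariant by
  \<open>std_normal_density_rotate\<close>.\<close>

lemma nn_integral_std_gauss_rotate:
  fixes h :: "real \<times> real \<Rightarrow> ennreal"
  assumes h[measurable]: "h \<in> borel_measurable (borel \<Otimes>\<^sub>M borel)"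
    and cs: "c\<^sup>2 + s\<^sup>2 = 1" "0 \<le> c"
  shows "(\<integral>\<^sup>+u. \<integral>\<^sup>+v. h (c * u + s * v, c * v - s * u) \<partial>std_gauss \<partial>std_gauss)
       = (\<integral>\<^sup>+u. \<integral>\<^sup>+v. h (u, v) \<partial>std_gauss \<partial>std_gauss)"
proof (cases "s = 0")
  \<comment> \<open>The substitutions divide by \<open>s\<close>; if \<open>s = 0\<close>, the sign
    condition on \<open>c\<close> leaves only the identity rotation.\<close>
  case True
  then have "c = 1" using cs by (simp add: power2_eq_1_iff)
  with True show ?thesis by simp
next
  case False
  let ?\<phi> = "\<lambda>x. ennreal (std_normal_density x)"
  have "(\<integral>\<^sup>+u. \<integral>\<^sup>+v. h (c * u + s * v, c * v - s * u) \<partial>std_gauss \<partial>std_gauss)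
      = (\<integral>\<^sup>+u. \<integral>\<^sup>+v. ?\<phi> u * (?\<phi> v * h (c * u + s * v, c * v - s * u)) \<partial>lborel \<partial>lborel)"
    by (simp add: nn_integral_std_gauss nn_integral_cmult)
  also have "\<dots> = (\<integral>\<^sup>+u. \<integral>\<^sup>+w. ennreal \<bar>1 / s\<bar> * (?\<phi> u * (?\<phi> ((w - c * u) / s) * h (w, (c * w - u) / s))) \<partial>lborel \<partial>lborel)"
  proof (rule nn_integral_cong)
    fix u :: real
    have eq: "c * u + s * ((w - c * u) / s) = w"
      "c * ((w - c * u) / s) - s * u = (c * w - u) / s"
      "- (c * u / s) + 1 / s * w = (w - c * u) / s" for w
    proof -
      show "c * u + s * ((w - c * u) / s) = w"
        using False by (simp add: field_simps)
      show "- (c * u / s) + 1 / s * w = (w - c * u) / s"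
        using False by (simp add: field_simps)
      have "c * ((w - c * u) / s) - s * u = (c * w - (c\<^sup>2 + s\<^sup>2) * u) / s"
        using False by (simp add: field_simps power2_eq_square)
      then show "c * ((w - c * u) / s) - s * u = (c * w - u) / s"
        using cs by simp
    qed
    show "(\<integral>\<^sup>+v. ?\<phi> u * (?\<phi> v * h (c * u + s * v, c * v - s * u)) \<partial>lborel)
       = (\<integral>\<^sup>+w. ennreal \<bar>1 / s\<bar> * (?\<phi> u * (?\<phi> ((w - c * u) / s) * h (w, (c * w - u) / s))) \<partial>lborel)"
      using False
      by (subst nn_integral_real_affine[where c="1/s" and t="- (c * u / s)"])
         (simp_all only: eq, simp_all add: nn_integral_cmult del: abs_divide)
  qed
  also have "\<dots> = (\<integral>\<^sup>+w. \<integral>\<^sup>+u. ennreal \<bar>1 / s\<bar> * (?\<phi> u * (?\<phi> ((w - c * u) / s) * h (w, (c * w - u) / s))) \<partial>lborel \<partial>lborel)"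
    by (rule lborel_pair.Fubini') measurable
  also have "\<dots> = (\<integral>\<^sup>+w. \<integral>\<^sup>+t. ?\<phi> w * (?\<phi> t * h (w, t)) \<partial>lborel \<partial>lborel)"
  proof (rule nn_integral_cong)
    fix w :: real
    have eq: "(w - c * (c * w + - s * t)) / s = s * w + c * t"
         "(c * w - (c * w + - s * t)) / s = t" for t
    proof -
      have "w - c * (c * w + - s * t) = (1 - c\<^sup>2) * w + c * s * t"
        by (simp add: power2_eq_square algebra_simps)
      also have "1 - c\<^sup>2 = s * s" using cs by (simp add: power2_eq_square algebra_simps)
      finally show "(w - c * (c * w + - s * t)) / s = s * w + c * t"
        using False by (simp add: field_simps)
    qed (use False in simp)
    have ds: "ennreal \<bar>- s\<bar> * (ennreal \<bar>1 / s\<bar> * x) = x" for x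
      using False by (simp add: mult.assoc[symmetric] ennreal_mult[symmetric] abs_mult[symmetric] del: abs_divide)
    have d: "?\<phi> (c * w + - s * t) * (?\<phi> (s * w + c * t) * h (w, t)) = ?\<phi> w * (?\<phi> t * h (w, t))" for t
      using std_normal_density_rotate[OF cs(1), of w t]
      by (simp add: mult.assoc[symmetric] ennreal_mult[symmetric])
    have "(\<integral>\<^sup>+u. ennreal \<bar>1 / s\<bar> * (?\<phi> u * (?\<phi> ((w - c * u) / s) * h (w, (c * w - u) / s))) \<partial>lborel)
      = ennreal \<bar>- s\<bar> * (\<integral>\<^sup>+t. ennreal \<bar>1 / s\<bar> * (?\<phi> w * (?\<phi> t * h (w, t))) \<partial>lborel)"
      using False
      by (subst nn_integral_real_affine[where c="- s" and t="c * w"])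
         (simp_all only: eq d, simp_all)
    also have "\<dots> = (\<integral>\<^sup>+t. ?\<phi> w * (?\<phi> t * h (w, t)) \<partial>lborel)"
      by (subst nn_integral_cmult) (measurable, simp only: ds)
    finally show "(\<integral>\<^sup>+u. ennreal \<bar>1 / s\<bar> * (?\<phi> u * (?\<phi> ((w - c * u) / s) * h (w, (c * w - u) / s))) \<partial>lborel)
      = (\<integral>\<^sup>+t. ?\<phi> w * (?\<phi> t * h (w, t)) \<partial>lborel)" .
  qed
  also have "\<dots> = (\<integral>\<^sup>+u. \<integral>\<^sup>+v. h (u, v) \<partial>std_gauss \<partial>std_gauss)"
    by (simp add: nn_integral_std_gauss nn_integral_cmult)
  finally show ?thesis .
qed

text \<open>The sign condition on \<open>x\<close> gives a nonnegative cosine, as the rotation lemma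
  asks for.\<close>

lemma polar_coordinates_ex:
  fixes x y :: real
  assumes "0 \<le> x"
  obtains r c s where "0 \<le> r" "0 \<le> c" "c\<^sup>2 + s\<^sup>2 = 1" "x = r * c" "y = r * s"
proof (cases "x = 0 \<and> y = 0")
  case True
  then show ?thesis using that[of 0 1 0] by simp
next
  case False
  define r where "r = sqrt (x\<^sup>2 + y\<^sup>2)"
  have r: "r\<^sup>2 = x\<^sup>2 + y\<^sup>2" "0 < r"
    using False by (auto simp: r_def sum_power2_gt_zero_iff)
  show ?thesis
    by (rule that[of r "x / r" "y / r"])
       (use r assms in \<open>auto simp: power_divide add_divide_distrib[symmetric]\<close>)
qed

text \<open>One elimination step in the style of Givens rotations. A rotation in the
  \<open>(u, w)\<close> plane moves all of the first form onto one variable; a second rotation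
  merges the two independent remainders of the second form into one. The triangular shape survives,
  and the three identities say that the variances and the covariance grow by the contribution of
  \<open>w\<close>.\<close>

lemma nn_integral_std_gauss_combine:
  fixes \<alpha> \<beta> \<gamma> a b :: real
  assumes "0 \<le> \<alpha>" "0 \<le> \<gamma>"
  shows "\<exists>\<alpha>' \<gamma>' \<beta>'. 0 \<le> \<alpha>' \<and> 0 \<le> \<gamma>' \<and>
    \<alpha>'\<^sup>2 = \<alpha>\<^sup>2 + a\<^sup>2 \<and> \<alpha>' * \<beta>' = \<alpha> * \<beta> + a * b \<and> \<beta>'\<^sup>2 + \<gamma>'\<^sup>2 = \<beta>\<^sup>2 + \<gamma>\<^sup>2 + b\<^sup>2 \<and>
    (\<forall>h\<in>borel_measurable (borel \<Otimes>\<^sub>M borel).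
      (\<integral>\<^sup>+w. \<integral>\<^sup>+u. \<integral>\<^sup>+v. h (\<alpha> * u + a * w, \<beta> * u + \<gamma> * v + b * w) \<partial>std_gauss \<partial>std_gauss \<partial>std_gauss)
    = (\<integral>\<^sup>+u. \<integral>\<^sup>+v. h (\<alpha>' * u, \<beta>' * u + \<gamma>' * v) \<partial>std_gauss \<partial>std_gauss))"
proof -
  obtain r c s where r: "0 \<le> r" "0 \<le> c" "c\<^sup>2 + s\<^sup>2 = 1" "\<alpha> = r * c" "a = r * s"
    using polar_coordinates_ex[OF assms(1)] .
  \<comment> \<open>\<open>\<beta>'\<close> and \<open>\<delta>\<close> are the coordinates of
    \<open>(\<beta>, b)\<close> along \<open>(c, s)\<close> and \<open>(-s, c)\<close>.\<close>
  define \<delta> where "\<delta> = b * c - \<beta> * s"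
  define \<beta>' where "\<beta>' = \<beta> * c + b * s"
  obtain r' c' s' where r': "0 \<le> r'" "0 \<le> c'" "c'\<^sup>2 + s'\<^sup>2 = 1" "\<gamma> = r' * c'" "\<delta> = r' * s'"
    using polar_coordinates_ex[OF assms(2)] .
  have b: "\<beta> = c * \<beta>' - s * \<delta>" "b = s * \<beta>' + c * \<delta>"
  proof -
    have "c * \<beta>' - s * \<delta> = (c\<^sup>2 + s\<^sup>2) * \<beta>" "s * \<beta>' + c * \<delta> = (c\<^sup>2 + s\<^sup>2) * b"
      by (simp_all add: \<beta>'_def \<delta>_def power2_eq_square algebra_simps)
    then show "\<beta> = c * \<beta>' - s * \<delta>" "b = s * \<beta>' + c * \<delta>" using r by simp_all
  qed
  show ?thesis
  proof (rule exI[of _ r], rule exI[of _ r'], rule exI[of _ \<beta>'], intro conjI ballI)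
    show "0 \<le> r" "0 \<le> r'" by fact+
    have "\<alpha>\<^sup>2 + a\<^sup>2 = (c\<^sup>2 + s\<^sup>2) * r\<^sup>2" by (simp add: r power2_eq_square algebra_simps)
    then show "r\<^sup>2 = \<alpha>\<^sup>2 + a\<^sup>2" using r by simp
    show "r * \<beta>' = \<alpha> * \<beta> + a * b" by (simp add: r \<beta>'_def algebra_simps)
    have "\<gamma>\<^sup>2 + \<delta>\<^sup>2 = (c'\<^sup>2 + s'\<^sup>2) * r'\<^sup>2" by (simp add: r' power2_eq_square algebra_simps)
    then have g: "\<gamma>\<^sup>2 + \<delta>\<^sup>2 = r'\<^sup>2" using r' by simp
    have "(c * \<beta>' - s * \<delta>)\<^sup>2 + (s * \<beta>' + c * \<delta>)\<^sup>2 = (c\<^sup>2 + s\<^sup>2) * (\<beta>'\<^sup>2 + \<delta>\<^sup>2)"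
      by (simp add: power2_eq_square algebra_simps)
    then have "\<beta>\<^sup>2 + b\<^sup>2 = (c\<^sup>2 + s\<^sup>2) * (\<beta>'\<^sup>2 + \<delta>\<^sup>2)"
      unfolding b(1)[symmetric] b(2)[symmetric] .
    then show "\<beta>'\<^sup>2 + r'\<^sup>2 = \<beta>\<^sup>2 + \<gamma>\<^sup>2 + b\<^sup>2" using r g by simp
  next
    fix h :: "real \<times> real \<Rightarrow> ennreal"
    assume h[measurable]: "h \<in> borel_measurable (borel \<Otimes>\<^sub>M borel)"
    let ?N = std_gauss
    have m[measurable_cong]: "sets ?N = sets borel" by simp
    have "(\<integral>\<^sup>+w. \<integral>\<^sup>+u. \<integral>\<^sup>+v. h (\<alpha> * u + a * w, \<beta> * u + \<gamma> * v + b * w) \<partial>?N \<partial>?N \<partial>?N)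
        = (\<integral>\<^sup>+u. \<integral>\<^sup>+w. \<integral>\<^sup>+v. h (\<alpha> * u + a * w, \<beta> * u + \<gamma> * v + b * w) \<partial>?N \<partial>?N \<partial>?N)"
      by (rule std_gauss2.Fubini') measurable
    also have "\<dots> = (\<integral>\<^sup>+u. \<integral>\<^sup>+w. (\<lambda>(p, q). \<integral>\<^sup>+v. h (r * p, \<beta>' * p + \<gamma> * v + \<delta> * q) \<partial>?N)
            (c * u + s * w, c * w - s * u) \<partial>?N \<partial>?N)"
    proof -
      have "\<alpha> * u + a * w = r * (c * u + s * w)" for u w
        by (simp add: r algebra_simps)
      moreover have "\<beta> * u + \<gamma> * v + b * w = \<beta>' * (c * u + s * w) + \<gamma> * v + \<delta> * (c * w - s * u)" for u v w
        using arg_cong2[OF b, of "\<lambda>x y. x * u + \<gamma> * v + y * w"] by (simp add: algebra_simps)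
      ultimately show ?thesis by (simp only: prod.case)
    qed
    also have "\<dots> = (\<integral>\<^sup>+u. \<integral>\<^sup>+w. \<integral>\<^sup>+v. h (r * u, \<beta>' * u + \<gamma> * v + \<delta> * w) \<partial>?N \<partial>?N \<partial>?N)"
      by (subst nn_integral_std_gauss_rotate[OF _ r(3,2)]) simp_all
    also have "\<dots> = (\<integral>\<^sup>+u. \<integral>\<^sup>+v. \<integral>\<^sup>+w. h (r * u, \<beta>' * u + \<gamma> * v + \<delta> * w) \<partial>?N \<partial>?N \<partial>?N)"
      by (rule nn_integral_cong, rule std_gauss2.Fubini') measurable
    also have "\<dots> = (\<integral>\<^sup>+u. \<integral>\<^sup>+v. \<integral>\<^sup>+w. (\<lambda>(p, q). h (r * u, \<beta>' * u + r' * p)) (c' * v + s' * w, c' * w - s' * v) \<partial>?N \<partial>?N \<partial>?N)"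
      by (simp add: r' algebra_simps)
    also have "\<dots> = (\<integral>\<^sup>+u. \<integral>\<^sup>+v. \<integral>\<^sup>+w. h (r * u, \<beta>' * u + r' * v) \<partial>?N \<partial>?N \<partial>?N)"
      by (rule nn_integral_cong, subst nn_integral_std_gauss_rotate[OF _ r'(3,2)]) simp_all
    also have "\<dots> = (\<integral>\<^sup>+u. \<integral>\<^sup>+v. h (r * u, \<beta>' * u + r' * v) \<partial>?N \<partial>?N)"
      by (simp add: std_gauss.emeasure_space_1[simplified])
    finally show "(\<integral>\<^sup>+w. \<integral>\<^sup>+u. \<integral>\<^sup>+v. h (\<alpha> * u + a * w, \<beta> * u + \<gamma> * v + b * w) \<partial>?N \<partial>?N \<partial>?N)
      = (\<integral>\<^sup>+u. \<integral>\<^sup>+v. h (r * u, \<beta>' * u + r' * v) \<partial>?N \<partial>?N)" .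
  qed
qed

text \<open>Adding the coordinates one at a time brings the pair to the triangular form of a
  Cholesky factor. The factor is only asserted to exist: when \<open>\<alpha> = 0\<close>, the
  covariance data do not determine \<open>\<beta>\<close>.\<close>

lemma nn_integral_gauss_vec_pair:
  fixes a b :: "nat \<Rightarrow> real"
  assumes "finite I"
  shows "\<exists>\<alpha> \<gamma> \<beta>. 0 \<le> \<alpha> \<and> 0 \<le> \<gamma> \<and> \<alpha>\<^sup>2 = (\<Sum>k\<in>I. (a k)\<^sup>2) \<and>
    \<alpha> * \<beta> = (\<Sum>k\<in>I. a k * b k) \<and> \<beta>\<^sup>2 + \<gamma>\<^sup>2 = (\<Sum>k\<in>I. (b k)\<^sup>2) \<and>
    (\<forall>h\<in>borel_measurable (borel \<Otimes>\<^sub>M borel).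
      (\<integral>\<^sup>+z. h (\<Sum>k\<in>I. a k * z k, \<Sum>k\<in>I. b k * z k) \<partial>PiM I (\<lambda>_. std_gauss))
    = (\<integral>\<^sup>+u. \<integral>\<^sup>+v. h (\<alpha> * u, \<beta> * u + \<gamma> * v) \<partial>std_gauss \<partial>std_gauss))"
  using assms
proof (induction I)
  case empty
  show ?case
    by (rule exI[of _ 0], rule exI[of _ 0], rule exI[of _ 0])
       (simp add: PiM_empty std_gauss.emeasure_space_1[simplified])
next
  case (insert i I)
  interpret product_sigma_finite "\<lambda>_::nat. std_gauss"
    by unfold_locales
  obtain \<alpha> \<gamma> \<beta> where IH: "0 \<le> \<alpha>" "0 \<le> \<gamma>" "\<alpha>\<^sup>2 = (\<Sum>k\<in>I. (a k)\<^sup>2)" "\<alpha> * \<beta> = (\<Sum>k\<in>I. a k * b k)"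
      "\<beta>\<^sup>2 + \<gamma>\<^sup>2 = (\<Sum>k\<in>I. (b k)\<^sup>2)"
    and IH_h: "\<forall>h\<in>borel_measurable (borel \<Otimes>\<^sub>M borel).
      (\<integral>\<^sup>+z. h (\<Sum>k\<in>I. a k * z k, \<Sum>k\<in>I. b k * z k) \<partial>PiM I (\<lambda>_. std_gauss))
    = (\<integral>\<^sup>+u. \<integral>\<^sup>+v. h (\<alpha> * u, \<beta> * u + \<gamma> * v) \<partial>std_gauss \<partial>std_gauss)"
    using insert.IH by (elim exE conjE)
  obtain \<alpha>' \<gamma>' \<beta>' where *: "0 \<le> \<alpha>'" "0 \<le> \<gamma>'"
      "\<alpha>'\<^sup>2 = \<alpha>\<^sup>2 + (a i)\<^sup>2" "\<alpha>' * \<beta>' = \<alpha> * \<beta> + a i * b i" "\<beta>'\<^sup>2 + \<gamma>'\<^sup>2 = \<beta>\<^sup>2 + \<gamma>\<^sup>2 + (b i)\<^sup>2"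
      and h': "\<forall>h\<in>borel_measurable (borel \<Otimes>\<^sub>M borel).
      (\<integral>\<^sup>+w. \<integral>\<^sup>+u. \<integral>\<^sup>+v. h (\<alpha> * u + a i * w, \<beta> * u + \<gamma> * v + b i * w) \<partial>std_gauss \<partial>std_gauss \<partial>std_gauss)
    = (\<integral>\<^sup>+u. \<integral>\<^sup>+v. h (\<alpha>' * u, \<beta>' * u + \<gamma>' * v) \<partial>std_gauss \<partial>std_gauss)"
    using nn_integral_std_gauss_combine[OF IH(1,2), of "a i" \<beta> "b i"] by (elim exE conjE)
  show ?case
  proof (rule exI[of _ \<alpha>'], rule exI[of _ \<gamma>'], rule exI[of _ \<beta>'], intro conjI ballI)
    fix h :: "real \<times> real \<Rightarrow> ennreal"
    assume h[measurable]: "h \<in> borel_measurable (borel \<Otimes>\<^sub>M borel)"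
    have "(\<integral>\<^sup>+z. h (\<Sum>k\<in>insert i I. a k * z k, \<Sum>k\<in>insert i I. b k * z k) \<partial>PiM (insert i I) (\<lambda>_. std_gauss))
      = (\<integral>\<^sup>+w. \<integral>\<^sup>+z. h (\<Sum>k\<in>insert i I. a k * (z(i := w)) k, \<Sum>k\<in>insert i I. b k * (z(i := w)) k)
           \<partial>PiM I (\<lambda>_. std_gauss) \<partial>std_gauss)"
      using insert by (intro product_nn_integral_insert_rev) measurable
    also have "\<dots> = (\<integral>\<^sup>+w. \<integral>\<^sup>+z. (\<lambda>(x, y). h (x + a i * w, y + b i * w)) (\<Sum>k\<in>I. a k * z k, \<Sum>k\<in>I. b k * z k)
           \<partial>PiM I (\<lambda>_. std_gauss) \<partial>std_gauss)"
    proof -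
      have "(\<Sum>k\<in>I. c k * (z(i := w)) k) = (\<Sum>k\<in>I. c k * z k)" for c z :: "nat \<Rightarrow> real" and w
        by (rule sum.cong) (use insert.hyps in auto)
      then have "(\<Sum>k\<in>insert i I. c k * (z(i := w)) k) = (\<Sum>k\<in>I. c k * z k) + c i * w" for c z :: "nat \<Rightarrow> real" and w
        using insert.hyps by (simp del: fun_upd_apply) simp
      then show ?thesis by simp
    qed
    also have "\<dots> = (\<integral>\<^sup>+w. \<integral>\<^sup>+u. \<integral>\<^sup>+v. h (\<alpha> * u + a i * w, \<beta> * u + \<gamma> * v + b i * w) \<partial>std_gauss \<partial>std_gauss \<partial>std_gauss)"
      by (rule nn_integral_cong, subst IH_h[rule_format]) simp_all
    also have "\<dots> = (\<integral>\<^sup>+u. \<integral>\<^sup>+v. h (\<alpha>' * u, \<beta>' * u + \<gamma>' * v) \<partial>std_gauss \<partial>std_gauss)"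
      by (rule h'[rule_format]) measurable
    finally show "(\<integral>\<^sup>+z. h (\<Sum>k\<in>insert i I. a k * z k, \<Sum>k\<in>insert i I. b k * z k) \<partial>PiM (insert i I) (\<lambda>_. std_gauss)) = \<dots>" .
  qed (use *(1-5) IH insert.hyps in \<open>simp_all add: add_ac\<close>)
qed

text \<open>For unit forms the identities of the triangular representation can be solved:
  \<open>\<alpha> = 1\<close>, \<open>\<beta> = \<rho>\<close> and
  \<open>\<gamma> = sqrt (1 - \<rho>^2)\<close>. Equal integrals of indicators then identify the
  laws.\<close>

lemma distr_gauss_vec_pair:
  fixes a b :: "nat \<Rightarrow> real"
  assumes "finite I"
    and "(\<Sum>k\<in>I. (a k)\<^sup>2) = 1" "(\<Sum>k\<in>I. (b k)\<^sup>2) = 1" "(\<Sum>k\<in>I. a k * b k) = \<rho>"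
  shows "distr (PiM I (\<lambda>_. std_gauss)) (borel \<Otimes>\<^sub>M borel) (\<lambda>z. (\<Sum>k\<in>I. a k * z k, \<Sum>k\<in>I. b k * z k))
    = distr (std_gauss \<Otimes>\<^sub>M std_gauss) (borel \<Otimes>\<^sub>M borel) (\<lambda>(u, v). (u, \<rho> * u + sqrt (1 - \<rho>\<^sup>2) * v))"
    (is "?L = ?R")
proof -
  obtain \<alpha> \<gamma> \<beta> where *: "0 \<le> \<alpha>" "0 \<le> \<gamma>"
    "\<alpha>\<^sup>2 = (\<Sum>k\<in>I. (a k)\<^sup>2)" "\<alpha> * \<beta> = (\<Sum>k\<in>I. a k * b k)" "\<beta>\<^sup>2 + \<gamma>\<^sup>2 = (\<Sum>k\<in>I. (b k)\<^sup>2)"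
    "\<forall>h\<in>borel_measurable (borel \<Otimes>\<^sub>M borel).
      (\<integral>\<^sup>+z. h (\<Sum>k\<in>I. a k * z k, \<Sum>k\<in>I. b k * z k) \<partial>PiM I (\<lambda>_. std_gauss))
    = (\<integral>\<^sup>+u. \<integral>\<^sup>+v. h (\<alpha> * u, \<beta> * u + \<gamma> * v) \<partial>std_gauss \<partial>std_gauss)"
    using nn_integral_gauss_vec_pair[OF assms(1), of a b] by (elim exE conjE)
  have \<alpha>: "\<alpha> = 1" using *(1,3) assms(2) by (simp add: power2_eq_1_iff)
  have \<beta>: "\<beta> = \<rho>" using *(4) assms(4) \<alpha> by simp
  have g: "\<gamma>\<^sup>2 = 1 - \<rho>\<^sup>2" using *(5) assms(3) \<beta> by simp
  then have \<gamma>: "\<gamma> = sqrt (1 - \<rho>\<^sup>2)" using *(2) by (metis real_sqrt_abs abs_of_nonneg)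
  show ?thesis
  proof (rule measure_eqI)
    fix X assume "X \<in> sets ?L"
    then have X[measurable]: "X \<in> sets (borel \<Otimes>\<^sub>M borel)" by simp
    have "emeasure ?L X = (\<integral>\<^sup>+x. indicator X x \<partial>?L)"
      by simp
    also have "\<dots> = (\<integral>\<^sup>+z. indicator X (\<Sum>k\<in>I. a k * z k, \<Sum>k\<in>I. b k * z k) \<partial>PiM I (\<lambda>_. std_gauss))"
      by (subst nn_integral_distr) auto
    also have "\<dots> = (\<integral>\<^sup>+u. \<integral>\<^sup>+v. indicator X (u, \<rho> * u + sqrt (1 - \<rho>\<^sup>2) * v) \<partial>std_gauss \<partial>std_gauss)"
      by (subst *(6)[rule_format]) (simp_all add: \<alpha> \<beta> \<gamma>)
    also have "\<dots> = (\<integral>\<^sup>+x. (\<lambda>(u, v). indicator X (u, \<rho> * u + sqrt (1 - \<rho>\<^sup>2) * v)) x \<partial>(std_gauss \<Otimes>\<^sub>M std_gauss))"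
      by (subst std_gauss.nn_integral_fst[symmetric]) simp_all
    also have "\<dots> = (\<integral>\<^sup>+x. indicator X x \<partial>?R)"
      by (subst nn_integral_distr) (auto simp: case_prod_unfold)
    also have "\<dots> = emeasure ?R X" by simp
    finally show "emeasure ?L X = emeasure ?R X" .
  qed simp
qed

section \<open>Decorrelation of even functions of correlated Gaussians\<close>

text \<open>Since \<open>2/5 < 1/2\<close>, the weight times the normal density is a multiple of the
  normal density of variance 5. The exponent \<open>2/5\<close> is the one reached by a product of
  two functions of growth \<open>exp (x^2 / 5)\<close>.\<close>

lemma integrable_std_gauss_exp: "integrable std_gauss (\<lambda>x. exp (2 / 5 * x\<^sup>2))"
proof -
  have "std_normal_density x *\<^sub>R exp (2 / 5 * x\<^sup>2) = sqrt 5 * normal_density 0 (sqrt 5) x" for x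
  proof -
    have "- x\<^sup>2 / 2 + 2 / 5 * x\<^sup>2 = - (x\<^sup>2 / 10)" by simp
    then have "exp (- x\<^sup>2 / 2) * exp (2 / 5 * x\<^sup>2) = exp (- (x\<^sup>2 / 10))"
      by (simp only: exp_add[symmetric])
    moreover have "sqrt 10 = sqrt 2 * sqrt 5"
      by (simp add: real_sqrt_mult[symmetric])
    ultimately show ?thesis
      by (simp add: normal_density_def real_sqrt_mult)
  qed
  then show ?thesis
    by (subst integrable_density) auto
qed

lemma
  fixes p q :: "real \<Rightarrow> real"
  assumes p: "integrable std_gauss p" and q: "integrable std_gauss q"
  shows integrable_std_gauss2_mult: "integrable (std_gauss \<Otimes>\<^sub>M std_gauss) (\<lambda>(x, y). p x * q y)"
    and integral_std_gauss2_mult: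
      "(\<integral>(x, y). p x * q y \<partial>(std_gauss \<Otimes>\<^sub>M std_gauss)) = (\<integral>x. p x \<partial>std_gauss) * (\<integral>x. q x \<partial>std_gauss)"
proof -
  have [measurable]: "p \<in> borel_measurable std_gauss" "q \<in> borel_measurable std_gauss"
    using p q by auto
  show i: "integrable (std_gauss \<Otimes>\<^sub>M std_gauss) (\<lambda>(x, y). p x * q y)"
  proof (rule std_gauss2.Fubini_integrable)
    show "(\<lambda>(x, y). p x * q y) \<in> borel_measurable (std_gauss \<Otimes>\<^sub>M std_gauss)" by measurable
    show "integrable std_gauss (\<lambda>x. \<integral>y. norm (case (x, y) of (x, y) \<Rightarrow> p x * q y) \<partial>std_gauss)"
      using p q by (simp add: abs_mult)
    show "AE x in std_gauss. integrable std_gauss (\<lambda>y. case (x, y) of (x, y) \<Rightarrow> p x * q y)"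
      using q by simp
  qed
  show "(\<integral>(x, y). p x * q y \<partial>(std_gauss \<Otimes>\<^sub>M std_gauss)) = (\<integral>x. p x \<partial>std_gauss) * (\<integral>x. q x \<partial>std_gauss)"
    using std_gauss2.integral_fst'[OF i] p q by simp
qed

text \<open>The density of a standard bivariate normal vector with correlation \<open>r\<close>, relative to
  the one with independent coordinates.\<close>
definition corr_kernel :: "real \<Rightarrow> real \<Rightarrow> real \<Rightarrow> real" where
  "corr_kernel r x y = exp ((r * x * y - r\<^sup>2 * (x\<^sup>2 + y\<^sup>2) / 2) / (1 - r\<^sup>2)) / sqrt (1 - r\<^sup>2)"

lemma corr_kernel_nonneg: "r\<^sup>2 \<le> 1 \<Longrightarrow> 0 \<le> corr_kernel r x y"
  by (simp add: corr_kernel_def)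

lemma borel_measurable_corr_kernel[measurable]:
  "(\<lambda>x. corr_kernel r (fst x) (snd x)) \<in> borel_measurable (borel \<Otimes>\<^sub>M borel)"
  unfolding corr_kernel_def by measurable

text \<open>The left side is the conditional density at \<open>y\<close> of
  \<open>r x + sqrt (1 - r^2) V\<close> with \<open>V\<close> standard normal; completing the square
  in the exponent extracts the factor \<open>std_normal_density y\<close>.\<close>

lemma std_normal_density_corr_kernel:
  assumes "r\<^sup>2 < 1"
  shows "std_normal_density ((y - r * x) / sqrt (1 - r\<^sup>2)) / sqrt (1 - r\<^sup>2)
    = std_normal_density y * corr_kernel r x y"
proof -
  have "1 - r\<^sup>2 > 0" using assms by simp
  then have "- ((y - r * x) / sqrt (1 - r\<^sup>2))\<^sup>2 / 2
     = - y\<^sup>2 / 2 + (r * x * y - r\<^sup>2 * (x\<^sup>2 + y\<^sup>2) / 2) / (1 - r\<^sup>2)"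
    by (simp add: power_divide field_simps) (simp add: power2_eq_square power4_eq_xxxx algebra_simps)
  then have "exp (- ((y - r * x) / sqrt (1 - r\<^sup>2))\<^sup>2 / 2)
    = exp (- y\<^sup>2 / 2) * exp ((r * x * y - r\<^sup>2 * (x\<^sup>2 + y\<^sup>2) / 2) / (1 - r\<^sup>2))"
    by (simp only: exp_add)
  then show ?thesis
    by (simp add: normal_density_def corr_kernel_def)
qed

text \<open>For fixed \<open>u\<close>, the substitution \<open>y = r u + sqrt (1 - r^2) v\<close>
  in the inner integral produces exactly this conditional density.\<close>

lemma distr_std_gauss2_corr:
  assumes r: "r\<^sup>2 < 1"
  shows "distr (std_gauss \<Otimes>\<^sub>M std_gauss) (borel \<Otimes>\<^sub>M borel) (\<lambda>(u, v). (u, r * u + sqrt (1 - r\<^sup>2) * v))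
    = density (std_gauss \<Otimes>\<^sub>M std_gauss) (\<lambda>x. corr_kernel r (fst x) (snd x))" (is "?L = ?R")
proof (rule measure_eqI)
  let ?g = "sqrt (1 - r\<^sup>2)"
  let ?\<phi> = "\<lambda>x. ennreal (std_normal_density x)"
  have g: "?g > 0" using r by simp
  have s: "sets (std_gauss \<Otimes>\<^sub>M std_gauss) = sets (borel \<Otimes>\<^sub>M borel)"
    by (intro sets_pair_measure_cong) simp_all
  show "sets ?L = sets ?R" by (simp add: s)
  fix X assume "X \<in> sets ?L"
  then have X[measurable]: "X \<in> sets (borel \<Otimes>\<^sub>M borel)" by simp
  have "emeasure ?L X = (\<integral>\<^sup>+x. indicator X x \<partial>?L)"
    by simp
  also have "\<dots> = (\<integral>\<^sup>+x. (\<lambda>(u, v). indicator X (u, r * u + ?g * v)) x \<partial>(std_gauss \<Otimes>\<^sub>M std_gauss))"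
    by (subst nn_integral_distr) (auto simp: case_prod_unfold)
  also have "\<dots> = (\<integral>\<^sup>+u. \<integral>\<^sup>+v. indicator X (u, r * u + ?g * v) \<partial>std_gauss \<partial>std_gauss)"
    by (subst std_gauss.nn_integral_fst[symmetric]) simp_all
  also have "\<dots> = (\<integral>\<^sup>+u. \<integral>\<^sup>+v. ennreal (corr_kernel r u v) * indicator X (u, v) \<partial>std_gauss \<partial>std_gauss)"
  proof (rule nn_integral_cong)
    fix u :: real
    have eq: "- (r * u / ?g) + 1 / ?g * y = (y - r * u) / ?g" "r * u + ?g * ((y - r * u) / ?g) = y" for y
      using g by (simp_all add: field_simps)
    have k: "ennreal \<bar>1 / ?g\<bar> * (?\<phi> ((y - r * u) / ?g) * z) = ?\<phi> y * (ennreal (corr_kernel r u y) * z)" for y z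
    proof -
      have "\<bar>1 / ?g\<bar> * std_normal_density ((y - r * u) / ?g) = std_normal_density y * corr_kernel r u y"
        using std_normal_density_corr_kernel[OF r, of y u] r by simp
      then show ?thesis
        using r by (simp add: mult.assoc[symmetric] ennreal_mult[symmetric] corr_kernel_nonneg)
    qed
    have "(\<integral>\<^sup>+v. indicator X (u, r * u + ?g * v) \<partial>std_gauss) = (\<integral>\<^sup>+v. ?\<phi> v * indicator X (u, r * u + ?g * v) \<partial>lborel)"
      by (rule nn_integral_std_gauss) measurable
    also have "\<dots> = ennreal \<bar>1 / ?g\<bar> * (\<integral>\<^sup>+y. ?\<phi> ((y - r * u) / ?g) * indicator X (u, y) \<partial>lborel)"
      using g
      by (subst nn_integral_real_affine[where c="1 / ?g" and t="- (r * u / ?g)"])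
         (simp_all only: eq, simp_all)
    also have "\<dots> = (\<integral>\<^sup>+y. ?\<phi> y * (ennreal (corr_kernel r u y) * indicator X (u, y)) \<partial>lborel)"
      by (subst nn_integral_cmult[symmetric]) (measurable, simp only: k)
    also have "\<dots> = (\<integral>\<^sup>+v. ennreal (corr_kernel r u v) * indicator X (u, v) \<partial>std_gauss)"
      by (subst nn_integral_std_gauss) (simp_all add: corr_kernel_def)
    finally show "(\<integral>\<^sup>+v. indicator X (u, r * u + ?g * v) \<partial>std_gauss)
        = (\<integral>\<^sup>+v. ennreal (corr_kernel r u v) * indicator X (u, v) \<partial>std_gauss)" .
  qed
  also have "\<dots> = (\<integral>\<^sup>+x. ennreal (corr_kernel r (fst x) (snd x)) * indicator X x \<partial>(std_gauss \<Otimes>\<^sub>M std_gauss))"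
    by (subst std_gauss.nn_integral_fst[symmetric]) simp_all
  also have "\<dots> = emeasure ?R X"
    using X by (subst emeasure_density) (simp_all add: s)
  finally show "emeasure ?L X = emeasure ?R X" .
qed

section \<open>Second-order expansion of the correlation kernel\<close>

lemma abs_exp_minus_linear_le:
  fixes m :: real
  shows "\<bar>exp m - 1 - m\<bar> \<le> m\<^sup>2 / 2 * exp \<bar>m\<bar>"
proof -
  obtain t where t: "\<bar>t\<bar> \<le> \<bar>m\<bar>" "exp m = (\<Sum>k<2. m ^ k / fact k) + exp t / fact 2 * m ^ 2"
    using Maclaurin_exp_le[of m 2] by blast
  have "\<bar>exp m - 1 - m\<bar> = exp t / 2 * m\<^sup>2"
    using t(2) by (simp add: numeral_2_eq_2)
  also have "\<dots> \<le> exp \<bar>m\<bar> / 2 * m\<^sup>2"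
    using t(1) by (intro mult_right_mono divide_right_mono) auto
  finally show ?thesis by (simp add: mult.commute)
qed

text \<open>With \<open>t = r^2\<close>, the kernel is \<open>exp m / sqrt (1 - t)\<close>. The
  error splits into the normalising factor, the Taylor remainder of \<open>exp m\<close>, and
  \<open>m - r x y\<close>; each is at most \<open>t\<close> times an expression in
  \<open>S = x^2 + y^2\<close> that the weight absorbs. The exponent \<open>1/8\<close> leaves room
  for a function of growth \<open>exp (x^2 / 5)\<close>, as \<open>1/8 + 1/5 < 2/5\<close>.\<close>

lemma abs_corr_kernel_minus_linear_le:
  assumes r: "\<bar>r\<bar> \<le> 1 / 8"
  shows "\<bar>corr_kernel r x y - 1 - r * x * y\<bar> \<le> 600 * r\<^sup>2 * exp ((x\<^sup>2 + y\<^sup>2) / 8)"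
proof -
  define S where "S = x\<^sup>2 + y\<^sup>2"
  define t where "t = r\<^sup>2"
  define m where "m = (r * x * y - t * S / 2) / (1 - t)"
  have S: "0 \<le> S" by (simp add: S_def)
  have t: "0 \<le> t" "t \<le> 1 / 64"
    using power_mono[OF r, of 2] by (auto simp: t_def power2_eq_square)
  have xy: "\<bar>x * y\<bar> \<le> S / 2"
    using sum_squares_bound[of x y] sum_squares_bound[of x "- y"] by (auto simp: S_def abs_le_iff)
  have rxy: "\<bar>r * x * y\<bar> \<le> \<bar>r\<bar> * (S / 2)"
    using mult_left_mono[OF xy, of "\<bar>r\<bar>"] by (simp add: abs_mult mult.assoc)
  have tr: "t \<le> \<bar>r\<bar> / 8"
    using mult_left_mono[OF r, of "\<bar>r\<bar>"] by (simp add: t_def power2_eq_square abs_mult[symmetric])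
  have m: "\<bar>m\<bar> \<le> 4 / 7 * \<bar>r\<bar> * S"
  proof -
    have "\<bar>r * x * y - t * S / 2\<bar> \<le> \<bar>r\<bar> * (S / 2) + (\<bar>r\<bar> / 8) * (S / 2)"
      using rxy mult_right_mono[OF tr, of "S / 2"] S mult_nonneg_nonneg[OF t(1) S]
      by linarith
    also have "\<dots> = 9 / 16 * \<bar>r\<bar> * S" by simp
    \<comment> \<open>\<open>9/16 = 4/7 * 63/64\<close>, and \<open>1 - t\<close> is at least
      \<open>63/64\<close>.\<close>
    also have "\<dots> \<le> 4 / 7 * \<bar>r\<bar> * S * (1 - t)"
    proof -
      have "9 / 16 * (\<bar>r\<bar> * S) \<le> 4 / 7 * (1 - t) * (\<bar>r\<bar> * S)"
        using t S by (intro mult_right_mono) auto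
      then show ?thesis by (simp add: algebra_simps)
    qed
    finally show ?thesis
      using t by (simp add: m_def divide_le_eq)
  qed
  have m14: "\<bar>m\<bar> \<le> S / 14"
    using m mult_right_mono[OF r S] by simp
  \<comment> \<open>Polynomial factors in \<open>S\<close> are traded for small exponentials;
    squaring this bound costs only \<open>exp (S / 28)\<close>.\<close>
  have expS: "S \<le> 56 * exp (S / 56)"
    using exp_ge_add_one_self[of "S / 56"] by linarith
  have m2: "m\<^sup>2 / 2 \<le> t * 512 * exp (S / 28)"
  proof -
    have "m\<^sup>2 \<le> (4 / 7 * \<bar>r\<bar> * S)\<^sup>2" using m by (metis abs_ge_zero power2_abs power_mono)
    also have "\<dots> = 16 / 49 * t * S\<^sup>2" by (simp add: t_def power2_eq_square)
    also have "\<dots> \<le> 16 / 49 * t * (56 * exp (S / 56))\<^sup>2"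
      using t S expS by (intro mult_left_mono power_mono) auto
    also have "(56 * exp (S / 56))\<^sup>2 = 3136 * exp (S / 28)"
      by (simp add: power_mult_distrib power2_eq_square exp_add[symmetric])
    finally show ?thesis by simp
  qed
  have g: "1 \<le> 1 / sqrt (1 - t)" "1 / sqrt (1 - t) \<le> 1 + t"
  proof -
    show "1 \<le> 1 / sqrt (1 - t)" using t by (simp add: le_divide_eq)
    \<comment> \<open>The bound \<open>1 / sqrt (1 - t) <= 1 + t\<close> amounts to this polynomial
      being nonnegative, which holds for small \<open>t\<close>.\<close>
    have "(1 + t)\<^sup>2 * (1 - t) - 1 = t * (1 - t - t * t)" by (simp add: power2_eq_square algebra_simps)
    moreover have "t * t \<le> 1 / 64 * (1 / 64)" using t by (intro mult_mono) auto
    moreover have "0 \<le> t * (1 - t - t * t)"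
      using t calculation(2) by (intro mult_nonneg_nonneg) auto
    ultimately have "1 \<le> (1 + t)\<^sup>2 * (1 - t)" by linarith
    then have "1 \<le> sqrt ((1 + t)\<^sup>2 * (1 - t))" by simp
    also have "\<dots> = (1 + t) * sqrt (1 - t)" using t by (simp add: real_sqrt_mult)
    finally show "1 / sqrt (1 - t) \<le> 1 + t" using t by (simp add: divide_le_eq)
  qed
  have 1: "\<bar>exp m / sqrt (1 - t) - exp m\<bar> \<le> t * exp (S / 14)"
  proof -
    have e: "exp m / sqrt (1 - t) - exp m = (1 / sqrt (1 - t) - 1) * exp m"
      by (simp add: left_diff_distrib)
    have "\<bar>exp m / sqrt (1 - t) - exp m\<bar> = (1 / sqrt (1 - t) - 1) * exp m"
      unfolding e abs_mult using g(1) by (simp only: abs_exp_cancel abs_of_nonneg diff_ge_0_iff_ge)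
    also have "\<dots> \<le> t * exp (S / 14)"
      using g t m14 by (intro mult_mono) auto
    finally show ?thesis .
  qed
  have 2: "\<bar>exp m - 1 - m\<bar> \<le> t * 512 * exp (S / 28) * exp (S / 14)"
    using abs_exp_minus_linear_le[of m] mult_mono[OF m2, of "exp \<bar>m\<bar>" "exp (S / 14)"] m14 t by auto
  have 3: "\<bar>m - r * x * y\<bar> \<le> t * S"
  proof -
    have "m - r * x * y = t * (r * x * y - S / 2) / (1 - t)"
      using t by (simp add: m_def field_simps)
    moreover have "\<bar>r * x * y - S / 2\<bar> \<le> 9 / 16 * S"
      using rxy mult_right_mono[OF r, of "S / 2"] S by linarith
    moreover have "9 / 16 * S \<le> S * (1 - t)"
      using mult_right_mono[of "9/16" "1 - t" S] t S by (simp add: algebra_simps)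
    moreover have "t * \<bar>r * x * y - S / 2\<bar> \<le> t * (S * (1 - t))"
      using calculation(2,3) t by (intro mult_left_mono) auto
    ultimately show ?thesis
      using t by (simp add: abs_mult divide_le_eq mult.assoc)
  qed
  have "\<bar>corr_kernel r x y - 1 - r * x * y\<bar> = \<bar>(exp m / sqrt (1 - t) - exp m) + (exp m - 1 - m) + (m - r * x * y)\<bar>"
    by (simp add: corr_kernel_def m_def S_def t_def)
  also have "\<dots> \<le> t * exp (S / 14) + t * 512 * exp (S / 28) * exp (S / 14) + t * (56 * exp (S / 56))"
    using 1 2 3 mult_left_mono[OF expS t(1)] by linarith
  \<comment> \<open>\<open>1/14 + 1/28 = 3/28 < 1/8\<close>, and the coefficients add up to
    \<open>1 + 512 + 56 = 569\<close>, below 600.\<close>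
  also have "\<dots> \<le> t * exp (S / 8) + t * 512 * exp (S / 8) + t * (56 * exp (S / 8))"
    using S t by (intro add_mono) (auto simp: mult.assoc exp_add[symmetric] intro!: mult_left_mono)
  also have "\<dots> \<le> 600 * t * exp (S / 8)" using t by simp
  finally show ?thesis by (simp add: t_def S_def)
qed



section \<open>Law and moments of a single linear form\<close>

lemma distr_gauss_vec:
  fixes a :: "nat \<Rightarrow> real"
  assumes "finite I" "(\<Sum>k\<in>I. (a k)\<^sup>2) = 1"
  shows "distr (PiM I (\<lambda>_. std_gauss)) borel (\<lambda>z. \<Sum>k\<in>I. a k * z k) = distr std_gauss borel (\<lambda>x. x)"
proof -
  let ?Z = "\<lambda>z. (\<Sum>k\<in>I. a k * z k, \<Sum>k\<in>I. a k * z k)"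
  have "distr (PiM I (\<lambda>_. std_gauss)) borel (\<lambda>z. \<Sum>k\<in>I. a k * z k)
    = distr (distr (PiM I (\<lambda>_. std_gauss)) (borel \<Otimes>\<^sub>M borel) ?Z) borel fst"
    by (subst distr_distr) (auto simp: comp_def)
  \<comment> \<open>The pair with both forms equal has correlation 1; only its first marginal is
    kept.\<close>
  also have "\<dots> = distr (distr (std_gauss \<Otimes>\<^sub>M std_gauss) (borel \<Otimes>\<^sub>M borel) (\<lambda>(u, v). (u, 1 * u + sqrt (1 - 1\<^sup>2) * v))) borel fst"
    using assms by (subst distr_gauss_vec_pair[where \<rho>=1]) (auto simp: power2_eq_square)
  also have "\<dots> = distr (distr (std_gauss \<Otimes>\<^sub>M std_gauss) std_gauss fst) borel (\<lambda>x. x)"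
    by (subst (1 2) distr_distr) (auto simp: comp_def case_prod_unfold)
  also have "distr (std_gauss \<Otimes>\<^sub>M std_gauss) std_gauss fst = std_gauss"
    by (rule std_gauss.distr_pair_fst)
  finally show ?thesis .
qed

lemma
  fixes a :: "nat \<Rightarrow> real" and f :: "real \<Rightarrow> real"
  assumes "finite I" "(\<Sum>k\<in>I. (a k)\<^sup>2) = 1" and [measurable]: "f \<in> borel_measurable borel"
  shows integrable_gauss_vec_iff:
      "integrable (PiM I (\<lambda>_. std_gauss)) (\<lambda>z. f (\<Sum>k\<in>I. a k * z k)) \<longleftrightarrow> integrable std_gauss f"
    and integral_gauss_vec:
      "(\<integral>z. f (\<Sum>k\<in>I. a k * z k) \<partial>PiM I (\<lambda>_. std_gauss)) = (\<integral>x. f x \<partial>std_gauss)"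
proof -
  have "integrable (PiM I (\<lambda>_. std_gauss)) (\<lambda>z. f (\<Sum>k\<in>I. a k * z k))
      \<longleftrightarrow> integrable (distr (PiM I (\<lambda>_. std_gauss)) borel (\<lambda>z. \<Sum>k\<in>I. a k * z k)) f"
    by (subst integrable_distr_eq) auto
  also have "\<dots> \<longleftrightarrow> integrable std_gauss f"
    unfolding distr_gauss_vec[OF assms(1,2)] by (subst integrable_distr_eq) auto
  finally show "integrable (PiM I (\<lambda>_. std_gauss)) (\<lambda>z. f (\<Sum>k\<in>I. a k * z k)) \<longleftrightarrow> integrable std_gauss f" .
  have "(\<integral>z. f (\<Sum>k\<in>I. a k * z k) \<partial>PiM I (\<lambda>_. std_gauss))
      = (\<integral>x. f x \<partial>distr (PiM I (\<lambda>_. std_gauss)) borel (\<lambda>z. \<Sum>k\<in>I. a k * z k))"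
    by (subst integral_distr) auto
  also have "\<dots> = (\<integral>x. f x \<partial>std_gauss)"
    unfolding distr_gauss_vec[OF assms(1,2)] by (subst integral_distr) auto
  finally show "(\<integral>z. f (\<Sum>k\<in>I. a k * z k) \<partial>PiM I (\<lambda>_. std_gauss)) = (\<integral>x. f x \<partial>std_gauss)" .
qed

text \<open>Equal to \<open>sqrt 5\<close>, but kept symbolic as an absolute constant in all
  bounds.\<close>

definition gauss_exp_moment :: real where
  "gauss_exp_moment = (\<integral>x. exp (2 / 5 * x\<^sup>2) \<partial>std_gauss)"

lemma gauss_exp_moment_ge_1: "1 \<le> gauss_exp_moment"
proof -
  have "(\<integral>x. 1 \<partial>std_gauss) \<le> gauss_exp_moment"
    unfolding gauss_exp_moment_def
    by (intro integral_mono integrable_std_gauss_exp) auto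
  then show ?thesis using std_gauss.prob_space by simp
qed

lemma
  fixes f :: "real \<Rightarrow> real"
  assumes [measurable]: "f \<in> borel_measurable borel" and "\<And>x. \<bar>f x\<bar> \<le> D * exp (2 / 5 * x\<^sup>2)"
  shows integrable_std_gauss_bound: "integrable std_gauss f"
    and integral_std_gauss_bound: "(\<integral>x. f x \<partial>std_gauss) \<le> D * gauss_exp_moment"
proof -
  have i: "integrable std_gauss (\<lambda>x. D * exp (2 / 5 * x\<^sup>2))"
    by (intro integrable_mult_right integrable_std_gauss_exp)
  show f: "integrable std_gauss f"
    by (rule Bochner_Integration.integrable_bound[OF i])
      (use assms(2) in \<open>auto intro: order_trans[OF _ abs_ge_self]\<close>)
  have "(\<integral>x. f x \<partial>std_gauss) \<le> (\<integral>x. D * exp (2 / 5 * x\<^sup>2) \<partial>std_gauss)"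
    using assms(2) by (intro integral_mono f i) (auto intro: order_trans[OF abs_ge_self])
  then show "(\<integral>x. f x \<partial>std_gauss) \<le> D * gauss_exp_moment"
    by (simp add: gauss_exp_moment_def)
qed

lemma exp_bound_mult:
  fixes D x :: real
  assumes "\<bar>y\<bar> \<le> D * exp (x\<^sup>2 / 5)" "\<bar>z\<bar> \<le> D' * exp (x\<^sup>2 / 5)"
  shows "\<bar>y * z\<bar> \<le> D * D' * exp (2 / 5 * x\<^sup>2)"
proof -
  have "\<bar>y * z\<bar> \<le> (D * exp (x\<^sup>2 / 5)) * (D' * exp (x\<^sup>2 / 5))"
    unfolding abs_mult using assms by (intro mult_mono) (auto intro: order_trans[OF abs_ge_zero])
  also have "\<dots> = D * D' * exp (2 / 5 * x\<^sup>2)"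
    by (simp add: mult_ac exp_add[symmetric])
  finally show ?thesis .
qed



text \<open>If \<open>|\<rho>| > 1/8\<close>, the claim is a second-moment bound, since
  \<open>600 \<rho>^2 >= 1\<close>. Otherwise the linear part \<open>1 + \<rho> x y\<close> of the
  kernel integrates \<open>f x * f y\<close> to \<open>(E f)^2 + \<rho> (E x f)^2 = 0\<close>, so
  only the kernel remainder of order \<open>\<rho>^2\<close> contributes.\<close>

lemma gauss_vec_covariance_bound:
  fixes a b :: "nat \<Rightarrow> real" and f :: "real \<Rightarrow> real"
  assumes I: "finite I" and a: "(\<Sum>k\<in>I. (a k)\<^sup>2) = 1" and b: "(\<Sum>k\<in>I. (b k)\<^sup>2) = 1"
    and \<rho>: "(\<Sum>k\<in>I. a k * b k) = \<rho>"
    and f[measurable]: "f \<in> borel_measurable borel" and D: "\<And>x. \<bar>f x\<bar> \<le> D * exp (x\<^sup>2 / 5)"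
    and f0: "(\<integral>x. f x \<partial>std_gauss) = 0" and f1: "(\<integral>x. x * f x \<partial>std_gauss) = 0"
  shows "integrable (PiM I (\<lambda>_. std_gauss)) (\<lambda>z. f (\<Sum>k\<in>I. a k * z k) * f (\<Sum>k\<in>I. b k * z k))" (is ?I)
    and "(\<integral>z. f (\<Sum>k\<in>I. a k * z k) * f (\<Sum>k\<in>I. b k * z k) \<partial>PiM I (\<lambda>_. std_gauss))
      \<le> 600 * gauss_exp_moment\<^sup>2 * D\<^sup>2 * \<rho>\<^sup>2" (is "?E \<le> _")
proof -
  let ?P = "PiM I (\<lambda>_. std_gauss)"
  let ?X = "\<lambda>z. \<Sum>k\<in>I. a k * z k" and ?Y = "\<lambda>z. \<Sum>k\<in>I. b k * z k"
  let ?J = gauss_exp_moment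
  have D0: "0 \<le> D" using D[of 0] by simp
  have fsq: "\<bar>(f x)\<^sup>2\<bar> \<le> D\<^sup>2 * exp (2 / 5 * x\<^sup>2)" for x
    using exp_bound_mult[OF D D] by (simp add: power2_eq_square)
  have f2: "integrable std_gauss (\<lambda>x. (f x)\<^sup>2)" "(\<integral>x. (f x)\<^sup>2 \<partial>std_gauss) \<le> D\<^sup>2 * ?J"
    using integrable_std_gauss_bound[OF _ fsq] integral_std_gauss_bound[OF _ fsq] by auto
  have X2: "integrable ?P (\<lambda>z. (f (?X z))\<^sup>2)" "(\<integral>z. (f (?X z))\<^sup>2 \<partial>?P) \<le> D\<^sup>2 * ?J"
    using integrable_gauss_vec_iff[OF I a, of "\<lambda>x. (f x)\<^sup>2"] integral_gauss_vec[OF I a, of "\<lambda>x. (f x)\<^sup>2"] f2 by auto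
  have Y2: "integrable ?P (\<lambda>z. (f (?Y z))\<^sup>2)" "(\<integral>z. (f (?Y z))\<^sup>2 \<partial>?P) \<le> D\<^sup>2 * ?J"
    using integrable_gauss_vec_iff[OF I b, of "\<lambda>x. (f x)\<^sup>2"] integral_gauss_vec[OF I b, of "\<lambda>x. (f x)\<^sup>2"] f2 by auto
  have amgm: "\<bar>x * y\<bar> \<le> (x\<^sup>2 + y\<^sup>2) / 2" for x y :: real
    using sum_squares_bound[of "\<bar>x\<bar>" "\<bar>y\<bar>"] by (simp add: abs_mult)
  have S2: "integrable ?P (\<lambda>z. ((f (?X z))\<^sup>2 + (f (?Y z))\<^sup>2) / 2)"
    using X2 Y2 by auto
  show I1: ?I
  proof (rule Bochner_Integration.integrable_bound[OF S2])
    have "norm (x * y) \<le> norm ((x\<^sup>2 + y\<^sup>2) / 2)" for x y :: real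
      using order_trans[OF amgm abs_ge_self] by (simp only: real_norm_def)
    then show "AE z in ?P. norm (f (?X z) * f (?Y z)) \<le> norm (((f (?X z))\<^sup>2 + (f (?Y z))\<^sup>2) / 2)"
      by (intro AE_I2)
  qed measurable
  have J1: "1 \<le> ?J" by (rule gauss_exp_moment_ge_1)
  show "?E \<le> 600 * ?J\<^sup>2 * D\<^sup>2 * \<rho>\<^sup>2"
  proof (cases "\<bar>\<rho>\<bar> \<le> 1 / 8")
    case False
    then have "(1 / 8)\<^sup>2 \<le> \<rho>\<^sup>2"
      by (intro abs_le_square_iff[THEN iffD1]) auto
    then have r: "1 \<le> 600 * \<rho>\<^sup>2" by (simp add: power2_eq_square)
    have "?E \<le> (\<integral>z. ((f (?X z))\<^sup>2 + (f (?Y z))\<^sup>2) / 2 \<partial>?P)"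
      by (intro integral_mono I1 S2) (rule order_trans[OF abs_ge_self amgm])
    also have "\<dots> \<le> D\<^sup>2 * ?J * 1" using X2 Y2 by simp
    also have "\<dots> \<le> D\<^sup>2 * ?J\<^sup>2 * (600 * \<rho>\<^sup>2)"
      using J1 r by (intro mult_mono) (auto simp: power2_eq_square)
    finally show ?thesis by (simp add: mult_ac)
  next
    case True
    let ?N2 = "std_gauss \<Otimes>\<^sub>M std_gauss"
    have N2[measurable_cong]: "sets ?N2 = sets (borel \<Otimes>\<^sub>M borel)"
      by (intro sets_pair_measure_cong) simp_all
    have r1: "\<rho>\<^sup>2 < 1"
      using True by (simp add: abs_square_less_1)
    let ?K = "\<lambda>x. corr_kernel \<rho> (fst x) (snd x)"
    let ?ff = "\<lambda>x. f (fst x) * f (snd x)"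
    have law: "distr ?P (borel \<Otimes>\<^sub>M borel) (\<lambda>z. (?X z, ?Y z)) = density ?N2 ?K"
      using distr_gauss_vec_pair[OF I a b \<rho>] distr_std_gauss2_corr[OF r1] by simp
    have E: "?E = (\<integral>x. ?K x * ?ff x \<partial>?N2)"
    proof -
      have "?E = (\<integral>x. ?ff x \<partial>distr ?P (borel \<Otimes>\<^sub>M borel) (\<lambda>z. (?X z, ?Y z)))"
        by (subst integral_distr) auto
      also have "\<dots> = (\<integral>x. ?K x *\<^sub>R ?ff x \<partial>?N2)"
        unfolding law by (rule integral_density) (use r1 in \<open>auto simp: corr_kernel_nonneg\<close>)
      finally show ?thesis by simp
    qed
    have IK: "integrable ?N2 (\<lambda>x. ?K x * ?ff x)"
    proof -
      have "integrable (distr ?P (borel \<Otimes>\<^sub>M borel) (\<lambda>z. (?X z, ?Y z))) ?ff"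
        using I1 by (subst integrable_distr_eq) auto
      then have "integrable ?N2 (\<lambda>x. ?K x *\<^sub>R ?ff x)"
        unfolding law by (subst (asm) integrable_density) (use r1 in \<open>auto simp: corr_kernel_nonneg\<close>)
      then show ?thesis by simp
    qed
    have x_exp: "\<bar>x\<bar> \<le> 5 * exp (x\<^sup>2 / 5)" and one_exp: "\<bar>1\<bar> \<le> 1 * exp (x\<^sup>2 / 5)" for x :: real
    proof -
      have "\<bar>x\<bar> \<le> 1 + x\<^sup>2"
        using zero_le_power2[of "\<bar>x\<bar> - 1 / 2"] by (simp add: power2_diff power_one_over)
      also have "\<dots> \<le> 5 * (1 + x\<^sup>2 / 5)" by simp
      also have "\<dots> \<le> 5 * exp (x\<^sup>2 / 5)" by (intro mult_left_mono exp_ge_add_one_self) auto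
      finally show "\<bar>x\<bar> \<le> 5 * exp (x\<^sup>2 / 5)" .
    qed simp
    have fi: "integrable std_gauss f"
      using integrable_std_gauss_bound[of "\<lambda>x. f x * 1", OF _ exp_bound_mult[OF D one_exp]] by simp
    have xfi: "integrable std_gauss (\<lambda>x. x * f x)"
      by (rule integrable_std_gauss_bound[OF _ exp_bound_mult[OF x_exp D]]) simp
    let ?l = "\<lambda>x. (1 + \<rho> * fst x * snd x) * ?ff x"
    have l: "integrable ?N2 ?l" "(\<integral>x. ?l x \<partial>?N2) = 0"
    proof -
      have eq: "?l = (\<lambda>x. (\<lambda>(x, y). f x * f y) x + \<rho> * (\<lambda>(x, y). (x * f x) * (y * f y)) x)"
        by (auto simp: algebra_simps)
      note i = integrable_std_gauss2_mult[OF fi fi] integrable_std_gauss2_mult[OF xfi xfi]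
      show "integrable ?N2 ?l"
        unfolding eq by (intro Bochner_Integration.integrable_add integrable_mult_right i)
      have "(\<integral>x. ?l x \<partial>?N2) = (\<integral>(x, y). f x * f y \<partial>?N2) + \<rho> * (\<integral>(x, y). (x * f x) * (y * f y) \<partial>?N2)"
        unfolding eq using i by simp
      then show "(\<integral>x. ?l x \<partial>?N2) = 0"
        by (simp only: integral_std_gauss2_mult[OF fi fi] integral_std_gauss2_mult[OF xfi xfi] f0 f1 mult_zero_left mult_zero_right add_0)
    qed
    \<comment> \<open>The weight \<open>exp ((x^2 + y^2) / 8)\<close> factorises, so one factor
      joins each copy of \<open>|f|\<close>; \<open>1/8 <= 1/5\<close> keeps the exponent within
      \<open>2/5\<close>.\<close>
    let ?g = "\<lambda>x. \<bar>f x\<bar> * exp (x\<^sup>2 / 8)"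
    have gb: "\<bar>?g x\<bar> \<le> D * 1 * exp (2 / 5 * x\<^sup>2)" for x
    proof -
      have "\<bar>exp (x\<^sup>2 / 8)\<bar> \<le> 1 * exp (x\<^sup>2 / 5)" by simp
      from exp_bound_mult[OF D this] show ?thesis by (simp add: abs_mult)
    qed
    have g: "integrable std_gauss ?g" "(\<integral>x. ?g x \<partial>std_gauss) \<le> D * ?J"
      using integrable_std_gauss_bound[OF _ gb] integral_std_gauss_bound[OF _ gb] by simp_all
    have gg: "integrable ?N2 (\<lambda>x. 600 * \<rho>\<^sup>2 * (\<lambda>(x, y). ?g x * ?g y) x)"
      by (intro integrable_mult_right integrable_std_gauss2_mult g)
    have "?E = (\<integral>x. ?K x * ?ff x - ?l x \<partial>?N2)"
      using E IK l by simp
    also have "\<dots> \<le> (\<integral>x. 600 * \<rho>\<^sup>2 * (\<lambda>(x, y). ?g x * ?g y) x \<partial>?N2)"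
    proof (intro integral_mono gg Bochner_Integration.integrable_diff IK l)
      fix x :: "real \<times> real"
      have "?K x * ?ff x - ?l x = (?K x - 1 - \<rho> * fst x * snd x) * ?ff x"
        by (simp add: algebra_simps)
      also have "\<dots> \<le> \<bar>?K x - 1 - \<rho> * fst x * snd x\<bar> * \<bar>?ff x\<bar>"
        by (metis abs_ge_self abs_mult)
      also have "\<dots> \<le> 600 * \<rho>\<^sup>2 * exp (((fst x)\<^sup>2 + (snd x)\<^sup>2) / 8) * \<bar>?ff x\<bar>"
        by (intro mult_right_mono abs_corr_kernel_minus_linear_le True) auto
      also have "\<dots> = 600 * \<rho>\<^sup>2 * (\<lambda>(x, y). ?g x * ?g y) x"
        by (cases x) (simp add: abs_mult exp_add add_divide_distrib)
      finally show "?K x * ?ff x - ?l x \<le> 600 * \<rho>\<^sup>2 * (\<lambda>(x, y). ?g x * ?g y) x" .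
    qed
    also have "\<dots> = 600 * \<rho>\<^sup>2 * ((\<integral>x. ?g x \<partial>std_gauss) * (\<integral>x. ?g x \<partial>std_gauss))"
      by (simp only: integral_mult_right_zero integral_std_gauss2_mult[OF g(1) g(1)])
    also have "\<dots> \<le> 600 * \<rho>\<^sup>2 * ((D * ?J) * (D * ?J))"
      using g(2) D0 J1 by (intro mult_left_mono mult_mono) (auto intro!: integral_nonneg_AE)
    finally show ?thesis by (simp add: power2_eq_square mult_ac)
  qed
qed

section \<open>Noise terms and the conditional second moment\<close>

lemma gram_diag: "gram d A i i = (\<Sum>k<d. (A i k)\<^sup>2)"
  by (simp add: gram_def power2_eq_square)

lemma gram_diag_nonneg: "0 \<le> gram d A i i"
  by (simp add: gram_diag sum_nonneg)

lemma gram_diag_eq_0: "gram d A i i = 0 \<Longrightarrow> k < d \<Longrightarrow> A i k = 0"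
  by (simp add: gram_diag sum_nonneg_eq_0_iff)

lemma frob_sq: "(frob d M)\<^sup>2 = (\<Sum>i<d. \<Sum>j<d. (M i j)\<^sup>2)"
  by (simp add: frob_def sum_nonneg)

lemma frob_nonneg: "0 \<le> frob d M"
  by (simp add: frob_def sum_nonneg)

text \<open>The square is expanded over pairs of coordinates. After normalising the rows of
  \<open>A\<close>, and with \<open>g = gram d A\<close>, the pair \<open>(i, j)\<close> has
  correlation \<open>g i j / sqrt (g i i * g j j)\<close>, so the weights cancel the denominator of
  its square and leave the squared matrix entry; all pairs together give the Frobenius norm.\<close>

lemma
  fixes A :: "nat \<Rightarrow> nat \<Rightarrow> real" and f :: "real \<Rightarrow> real"
  assumes f[measurable]: "f \<in> borel_measurable borel" and D: "\<And>x. \<bar>f x\<bar> \<le> D * exp (x\<^sup>2 / 5)"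
    and f0: "(\<integral>x. f x \<partial>std_gauss) = 0" and f1: "(\<integral>x. x * f x \<partial>std_gauss) = 0"
    and T: "T \<subseteq> {..<d}"
  defines "W \<equiv> (\<lambda>z. \<Sum>i\<in>T. gram d A i i * f ((\<Sum>k<d. A i k * z k) / sqrt (gram d A i i)))"
  shows integrable_gauss_noise_sq: "integrable (std_gauss_vec d) (\<lambda>z. (W z)\<^sup>2)"
    and integral_gauss_noise_sq_le:
      "(\<integral>z. (W z)\<^sup>2 \<partial>std_gauss_vec d) \<le> 600 * gauss_exp_moment\<^sup>2 * D\<^sup>2 * (frob d (gram d A))\<^sup>2"
proof -
  let ?P = "std_gauss_vec d"
  let ?c = "600 * gauss_exp_moment\<^sup>2 * D\<^sup>2"
  define g where "g i j = gram d A i j" for i j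
  define F where "F i z = f ((\<Sum>k<d. A i k * z k) / sqrt (g i i))" for i z
  have "integrable ?P (\<lambda>z. g i i * F i z * (g j j * F j z)) \<and>
     (\<integral>z. g i i * F i z * (g j j * F j z) \<partial>?P) \<le> ?c * (g i j)\<^sup>2" for i j
  proof (cases "g i i = 0 \<or> g j j = 0")
    \<comment> \<open>A row of zero variance cannot be normalised, but its weight makes the product
      vanish.\<close>
    case True
    then show ?thesis by auto
  next
    case False
    then have pos: "0 < g i i" "0 < g j j"
      using gram_diag_nonneg[of d A] by (auto simp: g_def less_le)
    let ?a = "\<lambda>i k. A i k / sqrt (g i i)"
    have F: "F i z = f (\<Sum>k<d. ?a i k * z k)" for i z
      by (simp add: F_def sum_divide_distrib)
    have unit: "(\<Sum>k<d. (?a i k)\<^sup>2) = 1" if "0 < g i i" for i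
    proof -
      have "(\<Sum>k<d. (?a i k)\<^sup>2) = (\<Sum>k<d. (A i k)\<^sup>2) / g i i"
        using that by (simp add: power_divide sum_divide_distrib)
      then show ?thesis using that by (simp add: g_def gram_diag)
    qed
    have \<rho>: "(\<Sum>k<d. ?a i k * ?a j k) = g i j / (sqrt (g i i) * sqrt (g j j))"
      by (simp add: g_def gram_def sum_divide_distrib)
    note * = gauss_vec_covariance_bound[OF finite_lessThan unit[OF pos(1)] unit[OF pos(2)] \<rho> f D f0 f1]
    have i: "integrable ?P (\<lambda>z. F i z * F j z)"
      using *(1) by (simp add: F std_gauss_vec_def)
    have "(\<integral>z. F i z * F j z \<partial>?P) \<le> ?c * (g i j / (sqrt (g i i) * sqrt (g j j)))\<^sup>2"
      using *(2) by (simp only: F std_gauss_vec_def)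
    then have "g i i * g j j * (\<integral>z. F i z * F j z \<partial>?P)
        \<le> g i i * g j j * (?c * (g i j / (sqrt (g i i) * sqrt (g j j)))\<^sup>2)"
      using pos by (intro mult_left_mono) auto
    also have "\<dots> = ?c * (g i j)\<^sup>2"
      using pos by (simp add: power_divide power_mult_distrib)
    finally have "g i i * g j j * (\<integral>z. F i z * F j z \<partial>?P) \<le> ?c * (g i j)\<^sup>2" .
    moreover have "(\<lambda>z. g i i * F i z * (g j j * F j z)) = (\<lambda>z. g i i * g j j * (F i z * F j z))"
      by (simp add: mult_ac)
    ultimately show ?thesis using i by simp
  qed
  note * = this[THEN conjunct1] this[THEN conjunct2]
  have W: "(W z)\<^sup>2 = (\<Sum>i\<in>T. \<Sum>j\<in>T. g i i * F i z * (g j j * F j z))" for z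
    by (simp add: W_def power2_eq_square sum_product F_def g_def)
  show "integrable ?P (\<lambda>z. (W z)\<^sup>2)"
    unfolding W by (intro Bochner_Integration.integrable_sum *)
  have "(\<integral>z. (W z)\<^sup>2 \<partial>?P) = (\<Sum>i\<in>T. \<Sum>j\<in>T. \<integral>z. g i i * F i z * (g j j * F j z) \<partial>?P)"
    unfolding W using *(1) by (simp add: Bochner_Integration.integral_sum Bochner_Integration.integrable_sum)
  also have "\<dots> \<le> (\<Sum>i\<in>T. \<Sum>j\<in>T. ?c * (g i j)\<^sup>2)"
    by (intro sum_mono *)
  also have "\<dots> \<le> (\<Sum>i<d. \<Sum>j<d. ?c * (g i j)\<^sup>2)"
  proof -
    have "(\<Sum>j\<in>T. ?c * (g i j)\<^sup>2) \<le> (\<Sum>j<d. ?c * (g i j)\<^sup>2)" for i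
      using T by (intro sum_mono2) auto
    then have "(\<Sum>i\<in>T. \<Sum>j\<in>T. ?c * (g i j)\<^sup>2) \<le> (\<Sum>i\<in>T. \<Sum>j<d. ?c * (g i j)\<^sup>2)"
      by (intro sum_mono)
    also have "\<dots> \<le> (\<Sum>i<d. \<Sum>j<d. ?c * (g i j)\<^sup>2)"
      using T by (intro sum_mono2 sum_nonneg) auto
    finally show ?thesis .
  qed
  also have "\<dots> = ?c * (frob d (gram d A))\<^sup>2"
    by (simp add: frob_sq g_def sum_distrib_left)
  finally show "(\<integral>z. (W z)\<^sup>2 \<partial>?P) \<le> ?c * (frob d (gram d A))\<^sup>2" .
qed

text \<open>The norm of \<open>c\<close> is scaled out, so a pointwise growth bound on
  \<open>x ^ (2 * p)\<close> becomes a moment bound for every linear form. If the norm is zero,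
  \<open>0 < p\<close> makes the power vanish.\<close>

lemma linear_form_even_moment:
  fixes c :: "nat \<Rightarrow> real" and p :: nat
  assumes "\<And>x :: real. x ^ (2 * p) \<le> D * exp (2 / 5 * x\<^sup>2)" and p: "0 < p"
  shows "integrable (std_gauss_vec d) (\<lambda>z. (\<Sum>k<d. c k * z k) ^ (2 * p)) \<and>
    (\<integral>z. (\<Sum>k<d. c k * z k) ^ (2 * p) \<partial>std_gauss_vec d) \<le> D * gauss_exp_moment * (\<Sum>k<d. (c k)\<^sup>2) ^ p"
proof (cases "(\<Sum>k<d. (c k)\<^sup>2) = 0")
  case True
  then have "\<And>k. k < d \<Longrightarrow> c k = 0" by (simp add: sum_nonneg_eq_0_iff)
  then show ?thesis using p by (simp add: zero_power)
next
  case False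
  define n where "n = sqrt (\<Sum>k<d. (c k)\<^sup>2)"
  have n: "0 < n" "n\<^sup>2 = (\<Sum>k<d. (c k)\<^sup>2)"
    using False by (auto simp: n_def sum_nonneg less_le)
  let ?X = "\<lambda>z. \<Sum>k<d. c k / n * z k"
  have unit: "(\<Sum>k<d. (c k / n)\<^sup>2) = 1"
    using False n(1) by (simp only: power_divide sum_divide_distrib[symmetric] n(2)) simp
  have np: "n ^ (2 * p) = (\<Sum>k<d. (c k)\<^sup>2) ^ p"
    by (simp only: power_mult n(2))
  have "(\<Sum>k<d. c k * z k) = n * ?X z" for z
    using n(1) by (simp add: sum_distrib_left)
  then have eq: "(\<Sum>k<d. c k * z k) ^ (2 * p) = (\<Sum>k<d. (c k)\<^sup>2) ^ p * (?X z) ^ (2 * p)" for z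
    by (simp only: power_mult_distrib np)
  have bnd: "\<bar>x ^ (2 * p)\<bar> \<le> D * exp (2 / 5 * x\<^sup>2)" for x
    using assms(1) by simp
  have b: "integrable std_gauss (\<lambda>x. x ^ (2 * p))" "(\<integral>x. x ^ (2 * p) \<partial>std_gauss) \<le> D * gauss_exp_moment"
    by (rule integrable_std_gauss_bound[OF _ bnd] integral_std_gauss_bound[OF _ bnd], measurable)+
  have "integrable (std_gauss_vec d) (\<lambda>z. (?X z) ^ (2 * p))"
    unfolding std_gauss_vec_def
    by (subst integrable_gauss_vec_iff[OF finite_lessThan unit, of "\<lambda>x. x ^ (2 * p)"]) (simp, rule b)
  moreover have "(\<integral>z. (?X z) ^ (2 * p) \<partial>std_gauss_vec d) \<le> D * gauss_exp_moment"
    unfolding std_gauss_vec_def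
    by (subst integral_gauss_vec[OF finite_lessThan unit, of "\<lambda>x. x ^ (2 * p)"]) (simp, rule b)
  then have "(\<Sum>k<d. (c k)\<^sup>2) ^ p * (\<integral>z. (?X z) ^ (2 * p) \<partial>std_gauss_vec d)
      \<le> (\<Sum>k<d. (c k)\<^sup>2) ^ p * (D * gauss_exp_moment)"
    by (intro mult_left_mono) (simp_all add: sum_nonneg)
  ultimately show ?thesis
    unfolding eq by (simp only: integral_mult_right_zero mult.commute[of "D * gauss_exp_moment"]) simp
qed

lemma power2_le_exp: "(x::real)\<^sup>2 \<le> 5 * exp (x\<^sup>2 / 5)"
  using exp_ge_add_one_self[of "x\<^sup>2 / 5"] by linarith

lemma
  fixes c :: "nat \<Rightarrow> real"
  shows integrable_linear_form_power2: "integrable (std_gauss_vec d) (\<lambda>z. (\<Sum>k<d. c k * z k)\<^sup>2)"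
    and integral_linear_form_power2_le:
      "(\<integral>z. (\<Sum>k<d. c k * z k)\<^sup>2 \<partial>std_gauss_vec d) \<le> 5 * gauss_exp_moment * (\<Sum>k<d. (c k)\<^sup>2)"
    and integrable_linear_form_power4: "integrable (std_gauss_vec d) (\<lambda>z. (\<Sum>k<d. c k * z k) ^ 4)"
    and integral_linear_form_power4_le:
      "(\<integral>z. (\<Sum>k<d. c k * z k) ^ 4 \<partial>std_gauss_vec d) \<le> 25 * gauss_exp_moment * (\<Sum>k<d. (c k)\<^sup>2)\<^sup>2"
proof -
  have 2: "x ^ (2 * 1) \<le> 5 * exp (2 / 5 * x\<^sup>2)" for x :: real
  proof -
    have "5 * exp (x\<^sup>2 / 5) \<le> 5 * exp (2 / 5 * x\<^sup>2)" by simp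
    from order_trans[OF power2_le_exp this] show ?thesis by (simp only: mult_1_right)
  qed
  have 4: "x ^ (2 * 2) \<le> 25 * exp (2 / 5 * x\<^sup>2)" for x :: real
  proof -
    have "\<bar>x\<^sup>2\<bar> \<le> 5 * exp (x\<^sup>2 / 5)" using power2_le_exp[of x] by simp
    from exp_bound_mult[OF this this] show ?thesis by (simp add: power4_eq_xxxx power2_eq_square)
  qed
  show "integrable (std_gauss_vec d) (\<lambda>z. (\<Sum>k<d. c k * z k)\<^sup>2)"
     "(\<integral>z. (\<Sum>k<d. c k * z k)\<^sup>2 \<partial>std_gauss_vec d) \<le> 5 * gauss_exp_moment * (\<Sum>k<d. (c k)\<^sup>2)"
     "integrable (std_gauss_vec d) (\<lambda>z. (\<Sum>k<d. c k * z k) ^ 4)"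
     "(\<integral>z. (\<Sum>k<d. c k * z k) ^ 4 \<partial>std_gauss_vec d) \<le> 25 * gauss_exp_moment * (\<Sum>k<d. (c k)\<^sup>2)\<^sup>2"
    using linear_form_even_moment[OF 2, of d c] linear_form_even_moment[OF 4, of d c] by simp_all
qed

section \<open>Tail integrals of the normal law and the centring constant\<close>

lemma integral_abs_ge_even:
  fixes h :: "real \<Rightarrow> real"
  assumes h: "integrable lborel h" and even: "\<And>z. h (- z) = h z" and t: "0 < t"
  shows "(\<integral>z. (if t \<le> \<bar>z\<bar> then h z else 0) \<partial>lborel) = 2 * (\<integral>z. (if t \<le> z then h z else 0) \<partial>lborel)"
proof -
  have m[measurable]: "h \<in> borel_measurable borel" using h by auto
  have i: "integrable lborel (\<lambda>z. if t \<le> z then h z else 0)"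
    by (rule Bochner_Integration.integrable_bound[OF h]) auto
  have i': "integrable lborel (\<lambda>z. if t \<le> - z then h z else 0)"
    by (rule Bochner_Integration.integrable_bound[OF h]) auto
  have "(\<integral>z. (if t \<le> z then h z else 0) \<partial>lborel) = (\<integral>z. (if t \<le> - z then h z else 0) \<partial>lborel)"
    by (subst lborel_integral_real_affine[where c="-1" and t=0]) (simp_all add: even cong: if_cong)
  moreover have "(\<lambda>z. if t \<le> \<bar>z\<bar> then h z else 0) = (\<lambda>z. (if t \<le> z then h z else 0) + (if t \<le> - z then h z else 0))"
    using t by (auto simp: fun_eq_iff)
  ultimately show ?thesis
    using i i' by simp
qed

lemma integrable_power2_std_normal_density: "integrable lborel (\<lambda>z. z\<^sup>2 * std_normal_density z)"
  using integrable_std_normal_moment[of 2] by (simp add: mult.commute)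

text \<open>\<open>- (z * std_normal_density z)\<close> is an antiderivative of the integrand and
  vanishes at infinity. Since \<open>t\<close> is at least 1, the integrand is nonnegative beyond
  \<open>t\<close>, so the fundamental theorem for nonnegative integrals applies.\<close>

lemma integral_std_normal_tail:
  assumes t: "1 \<le> t"
  shows "(\<integral>z. (if t \<le> z then (z\<^sup>2 - 1) * std_normal_density z else 0) \<partial>lborel) = t * std_normal_density t"
proof -
  let ?F = "\<lambda>z::real. - (z * std_normal_density z)"
  define K where "K = 1 / sqrt (2 * pi)"
  have \<phi>: "std_normal_density = (\<lambda>z. K * exp (- (z\<^sup>2 / 2)))"
    by (simp add: fun_eq_iff std_normal_density_def K_def)
  have lim: "(?F \<longlongrightarrow> 0) at_top"
  proof (rule Lim_null_comparison)
    show "\<forall>\<^sub>F z in at_top. norm (?F z) \<le> z ^ 1 / exp z"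
    \<comment> \<open>From 2 on, \<open>z^2 / 2 >= z\<close>, which bounds the density by
      \<open>exp (- z)\<close>.\<close>
    proof (rule eventually_at_top_linorderI[of 2])
      fix z :: real assume z: "2 \<le> z"
      have "z * 2 \<le> z * z" using z by (intro mult_left_mono) auto
      then have "exp (- z\<^sup>2 / 2) \<le> exp (- z)" by (simp add: power2_eq_square)
      moreover have "1 / sqrt (2 * pi) \<le> 1"
        using pi_gt3 by (simp add: divide_le_eq)
      ultimately have "std_normal_density z \<le> 1 * exp (- z)"
        unfolding std_normal_density_def by (intro mult_mono) auto
      then have "z * std_normal_density z \<le> z * exp (- z)" using z by (intro mult_left_mono) auto
      then show "norm (?F z) \<le> z ^ 1 / exp z"
        using z by (simp add: exp_minus field_simps)
    qed
    show "((\<lambda>z::real. z ^ 1 / exp z) \<longlongrightarrow> 0) at_top" by (rule tendsto_power_div_exp_0)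
  qed
  have "(\<integral>\<^sup>+z. ennreal ((z\<^sup>2 - 1) * std_normal_density z) * indicator {t ..} z \<partial>lborel) = ennreal (0 - ?F t)"
  proof (rule nn_integral_FTC_atLeast[OF _ _ _ lim])
    fix z :: real
    show "DERIV ?F z :> (z\<^sup>2 - 1) * std_normal_density z"
      unfolding \<phi>
      by (auto intro!: derivative_eq_intros simp: algebra_simps power2_eq_square)
    assume "t \<le> z"
    then have "1 \<le> z\<^sup>2" using t by simp
    then show "0 \<le> (z\<^sup>2 - 1) * std_normal_density z" by simp
  qed measurable
  moreover have "ennreal (if t \<le> z then (z\<^sup>2 - 1) * std_normal_density z else 0)
      = ennreal ((z\<^sup>2 - 1) * std_normal_density z) * indicator {t ..} z" for z
    by (auto split: split_indicator)
  moreover have "0 \<le> (if t \<le> z then (z\<^sup>2 - 1) * std_normal_density z else 0)" for z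
    using t by (auto intro!: mult_nonneg_nonneg)
  ultimately show ?thesis
    using t by (subst integral_eq_nn_integral) auto
qed

text \<open>A lower bound of Mills type: on \<open>[t, t + 1/t]\<close> one has
  \<open>z^2 <= t^2 + 3\<close>, so the density loses at most the factor \<open>exp (- 3/2)\<close>
  there, and the interval has length \<open>1/t\<close>.\<close>

lemma std_normal_tail_lower_bound:
  assumes t: "1 \<le> t"
  shows "std_normal_density t \<le> exp (3 / 2) * t * (\<integral>z. (if t \<le> z then std_normal_density z else 0) \<partial>lborel)"
proof -
  have i: "integrable lborel (\<lambda>z. if t \<le> z then std_normal_density z else 0)"
    by (rule Bochner_Integration.integrable_bound[OF integrable_normal_density[of 1 0]]) auto
  have "(\<integral>z. exp (- 3 / 2) * std_normal_density t * indicator {t..t + 1 / t} z \<partial>lborel)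
      \<le> (\<integral>z. (if t \<le> z then std_normal_density z else 0) \<partial>lborel)"
  proof (rule integral_mono[OF _ i])
    show "integrable lborel (\<lambda>z. exp (- 3 / 2) * std_normal_density t * indicator {t..t + 1 / t} z)"
      using t by (intro integrable_mult_right integrable_real_indicator) (simp_all add: emeasure_lborel_Icc_eq)
    fix z :: real
    have "exp (- 3 / 2) * std_normal_density t \<le> std_normal_density z" if z: "t \<le> z" "z \<le> t + 1 / t"
    proof -
      have "z\<^sup>2 \<le> (t + 1 / t)\<^sup>2" using z t by (intro power_mono) auto
      also have "\<dots> = t\<^sup>2 + 2 + 1 / t\<^sup>2" using t by (simp add: power2_sum power_divide)
      also have "\<dots> \<le> t\<^sup>2 + 3" using t by simp
      finally have "exp (- 3 / 2 + - t\<^sup>2 / 2) \<le> exp (- z\<^sup>2 / 2)" by simp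
      then show ?thesis
        unfolding std_normal_density_def exp_add by (simp add: field_simps)
    qed
    then show "exp (- 3 / 2) * std_normal_density t * indicator {t..t + 1 / t} z
      \<le> (if t \<le> z then std_normal_density z else 0)"
      by (auto split: split_indicator)
  qed
  then have "exp (- 3 / 2) * std_normal_density t / t \<le> (\<integral>z. (if t \<le> z then std_normal_density z else 0) \<partial>lborel)"
    using t by simp
  then show ?thesis
    using t by (simp add: divide_le_eq exp_minus field_simps)
qed

definition tail_const :: real where "tail_const = 1 + exp (3 / 2)"

text \<open>By the tail integral above, the conditional second moment is
  \<open>1 + t \<phi>(t) / P(Z >= t)\<close> with \<open>\<phi>\<close> the normal density, and the
  Mills bound makes the fraction at most \<open>exp (3/2) * t^2\<close>. The last claim frees the
  definition of its division, after checking that the tail probability is positive.\<close>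

lemma
  assumes t: "1 \<le> t"
  shows cond_second_moment_nonneg: "0 \<le> cond_second_moment t"
    and cond_second_moment_le: "cond_second_moment t \<le> tail_const * t\<^sup>2"
    and cond_second_moment_eq: "cond_second_moment t * (\<integral>z. (if t \<le> \<bar>z\<bar> then std_normal_density z else 0) \<partial>lborel)
      = (\<integral>z. (if t \<le> \<bar>z\<bar> then z\<^sup>2 * std_normal_density z else 0) \<partial>lborel)"
proof -
  let ?N = "\<integral>z. (if t \<le> z then z\<^sup>2 * std_normal_density z else 0) \<partial>lborel"
  let ?D = "\<integral>z. (if t \<le> z then std_normal_density z else 0) \<partial>lborel"
  have N: "(\<integral>z. (if t \<le> \<bar>z\<bar> then z\<^sup>2 * std_normal_density z else 0) \<partial>lborel) = 2 * ?N"
    using t by (intro integral_abs_ge_even integrable_power2_std_normal_density) (auto simp: normal_density_def)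
  have D: "(\<integral>z. (if t \<le> \<bar>z\<bar> then std_normal_density z else 0) \<partial>lborel) = 2 * ?D"
    using t by (intro integral_abs_ge_even integrable_normal_density) (auto simp: normal_density_def)
  have i: "integrable lborel (\<lambda>z. if t \<le> z then std_normal_density z else 0)"
    by (rule Bochner_Integration.integrable_bound[OF integrable_normal_density[of 1 0]]) auto
  have i2: "integrable lborel (\<lambda>z. if t \<le> z then z\<^sup>2 * std_normal_density z else 0)"
    by (rule Bochner_Integration.integrable_bound[OF integrable_power2_std_normal_density]) auto
  have "?N - ?D = (\<integral>z. (if t \<le> z then z\<^sup>2 * std_normal_density z else 0) - (if t \<le> z then std_normal_density z else 0) \<partial>lborel)"
    using i i2 by simp
  also have "\<dots> = t * std_normal_density t"
    unfolding integral_std_normal_tail[OF t, symmetric]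
    by (intro Bochner_Integration.integral_cong) (auto simp: algebra_simps)
  finally have ND: "?N = ?D + t * std_normal_density t" by simp
  have low: "std_normal_density t \<le> exp (3 / 2) * t * ?D"
    by (rule std_normal_tail_lower_bound[OF t])
  have Dpos: "0 < ?D"
  proof (rule ccontr)
    assume "\<not> 0 < ?D"
    then have "exp (3 / 2) * t * ?D \<le> 0" using t by (intro mult_nonneg_nonpos) auto
    then show False using low normal_density_pos[of 1 0 t] by simp
  qed
  have eq: "cond_second_moment t = ?N / ?D"
    unfolding cond_second_moment_def N D by simp
  show "cond_second_moment t * (\<integral>z. (if t \<le> \<bar>z\<bar> then std_normal_density z else 0) \<partial>lborel)
      = (\<integral>z. (if t \<le> \<bar>z\<bar> then z\<^sup>2 * std_normal_density z else 0) \<partial>lborel)"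
    unfolding eq N D using Dpos by simp
  show "0 \<le> cond_second_moment t"
    unfolding eq ND using t Dpos by simp
  have "t * std_normal_density t \<le> t * (exp (3 / 2) * t * ?D)"
    using t low by (intro mult_left_mono) auto
  moreover have "?D \<le> t\<^sup>2 * ?D" using t Dpos by simp
  ultimately have "?N \<le> tail_const * t\<^sup>2 * ?D"
    unfolding ND tail_const_def by (simp add: algebra_simps power2_eq_square)
  then show "cond_second_moment t \<le> tail_const * t\<^sup>2"
    unfolding eq using Dpos by (simp add: divide_le_eq)
qed

text \<open>The sparse-regime summand of \<open>Qhat\<close> at a coordinate without signal,
  standardised to unit variance.\<close>

definition thr_sq :: "real \<Rightarrow> real \<Rightarrow> real" where
  "thr_sq t x = (if \<bar>x\<bar> > t then x\<^sup>2 - cond_second_moment t else 0)"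

lemma borel_measurable_thr_sq[measurable]: "thr_sq t \<in> borel_measurable borel"
  unfolding thr_sq_def by measurable

text \<open>Beyond the threshold, growth \<open>exp (x^2 / 8)\<close> would do; weakening it to
  \<open>exp (x^2 / 5)\<close> frees \<open>3 x^2 / 40 >= t^2 / 18\<close> in the exponent. Squared,
  this gain becomes \<open>exp (- t^2 / 9)\<close> and pays for the Frobenius norm.\<close>

lemma thr_sq_bound:
  assumes t: "1 \<le> t"
  shows "\<bar>thr_sq t x\<bar> \<le> (8 * tail_const * exp (- t\<^sup>2 / 18)) * exp (x\<^sup>2 / 5)"
proof (cases "\<bar>x\<bar> > t")
  case True
  then have tx: "t\<^sup>2 \<le> x\<^sup>2" using t power_mono[of t "\<bar>x\<bar>" 2] by simp
  have C1: "1 \<le> tail_const" by (simp add: tail_const_def)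
  have "\<bar>thr_sq t x\<bar> \<le> tail_const * x\<^sup>2"
  proof -
    have "tail_const * t\<^sup>2 \<le> tail_const * x\<^sup>2" using C1 tx by simp
    moreover have "1 * x\<^sup>2 \<le> tail_const * x\<^sup>2" using C1 by (intro mult_right_mono) auto
    moreover have "thr_sq t x = x\<^sup>2 - cond_second_moment t" using True by (simp add: thr_sq_def)
    ultimately show ?thesis
      using cond_second_moment_nonneg[OF t] cond_second_moment_le[OF t] zero_le_power2[of x]
      unfolding abs_le_iff by linarith
  qed
  also have "\<dots> \<le> tail_const * (8 * exp (x\<^sup>2 / 8))"
    using C1 exp_ge_add_one_self[of "x\<^sup>2 / 8"] by (intro mult_left_mono) linarith+
  also have "\<dots> \<le> tail_const * (8 * exp (- t\<^sup>2 / 18 + x\<^sup>2 / 5))"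
  proof -
    have "x\<^sup>2 / 8 \<le> - t\<^sup>2 / 18 + x\<^sup>2 / 5" using tx zero_le_power2[of x] by linarith
    then show ?thesis using C1 by (intro mult_left_mono) auto
  qed
  finally show ?thesis by (simp add: exp_add[symmetric] mult_ac)
next
  case False
  then show ?thesis by (simp add: thr_sq_def tail_const_def add_nonneg_nonneg)
qed

text \<open>The mean vanishes because the conditional second moment is the right centring; the
  integral against \<open>x\<close> vanishes by oddness.\<close>

lemma integral_thr_sq:
  assumes t: "1 \<le> t"
  shows "(\<integral>x. thr_sq t x \<partial>std_gauss) = 0" "(\<integral>x. x * thr_sq t x \<partial>std_gauss) = 0"
proof -
  let ?\<beta> = "cond_second_moment t"
  have i: "integrable lborel (\<lambda>z. if t \<le> \<bar>z\<bar> then std_normal_density z else 0)"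
    by (rule Bochner_Integration.integrable_bound[OF integrable_normal_density[of 1 0]]) auto
  have i2: "integrable lborel (\<lambda>z. if t \<le> \<bar>z\<bar> then z\<^sup>2 * std_normal_density z else 0)"
    by (rule Bochner_Integration.integrable_bound[OF integrable_power2_std_normal_density]) auto
  have "(\<integral>x. thr_sq t x \<partial>std_gauss) = (\<integral>x. std_normal_density x *\<^sub>R thr_sq t x \<partial>lborel)"
    by (rule integral_density) auto
  also have "\<dots> = (\<integral>x. (if t \<le> \<bar>x\<bar> then x\<^sup>2 * std_normal_density x else 0)
      - ?\<beta> * (if t \<le> \<bar>x\<bar> then std_normal_density x else 0) \<partial>lborel)"
  \<comment> \<open>The estimator thresholds with \<open>>\<close> while the conditional moment uses
    \<open>\<le>\<close>; the two differ only at the points \<open>t\<close> and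
    \<open>- t\<close>.\<close>
  proof (rule integral_cong_AE)
    have "AE x in lborel. x \<noteq> t" "AE x in lborel. x \<noteq> - t"
      by (rule AE_lborel_singleton)+
    then show "AE x in lborel. std_normal_density x *\<^sub>R thr_sq t x
      = (if t \<le> \<bar>x\<bar> then x\<^sup>2 * std_normal_density x else 0) - ?\<beta> * (if t \<le> \<bar>x\<bar> then std_normal_density x else 0)"
      by eventually_elim (auto simp: thr_sq_def algebra_simps)
  qed measurable
  also have "\<dots> = 0"
    using i i2 cond_second_moment_eq[OF t] by simp
  finally show "(\<integral>x. thr_sq t x \<partial>std_gauss) = 0" .
  have "(\<integral>x. x * thr_sq t x \<partial>std_gauss) = (\<integral>x. std_normal_density x *\<^sub>R (x * thr_sq t x) \<partial>lborel)"
    by (rule integral_density) auto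
  also have "\<dots> = - (\<integral>x. std_normal_density x *\<^sub>R (x * thr_sq t x) \<partial>lborel)"
    by (subst lborel_integral_real_affine[where c="-1" and t=0])
       (simp_all add: thr_sq_def normal_density_def cong: if_cong)
  finally show "(\<integral>x. x * thr_sq t x \<partial>std_gauss) = 0"
    by (simp add: integral_density)
qed

text \<open>The same two cancellations for the dense regime, where nothing is thresholded and the
  centring is the variance 1.\<close>

lemma integral_std_gauss_square_minus_1:
  "(\<integral>x. x\<^sup>2 - 1 \<partial>std_gauss) = 0" "(\<integral>x. x * (x\<^sup>2 - 1) \<partial>std_gauss) = 0"
proof -
  have "(\<integral>x. x\<^sup>2 - 1 \<partial>std_gauss) = (\<integral>x. std_normal_density x *\<^sub>R (x\<^sup>2 - 1) \<partial>lborel)"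
    by (rule integral_density) auto
  also have "\<dots> = (\<integral>x. std_normal_density x * x ^ (2 * 1) - std_normal_density x \<partial>lborel)"
    by (simp add: right_diff_distrib)
  also have "\<dots> = 0"
    using integrable_std_normal_moment[of 2] integral_std_normal_moment_even[of 1]
      integrable_normal_density[of 1 0] by (simp add: fact_numeral)
  finally show "(\<integral>x. x\<^sup>2 - 1 \<partial>std_gauss) = 0" .
  have "(\<integral>x. x * (x\<^sup>2 - 1) \<partial>std_gauss) = (\<integral>x. std_normal_density x *\<^sub>R (x * (x\<^sup>2 - 1)) \<partial>lborel)"
    by (rule integral_density) auto
  also have "\<dots> = - (\<integral>x. std_normal_density x *\<^sub>R (x * (x\<^sup>2 - 1)) \<partial>lborel)"
    by (subst lborel_integral_real_affine[where c="-1" and t=0])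
       (simp_all add: normal_density_def)
  finally show "(\<integral>x. x * (x\<^sup>2 - 1) \<partial>std_gauss) = 0"
    by (simp add: integral_density)
qed

lemma abs_square_minus_1_le: "\<bar>x\<^sup>2 - 1\<bar> \<le> 5 * exp ((x::real)\<^sup>2 / 5)"
proof -
  have "1 \<le> exp (x\<^sup>2 / 5)" by simp
  then show ?thesis using power2_le_exp[of x] zero_le_power2[of x] unfolding abs_le_iff by linarith
qed

section \<open>Risk of the quadratic functional estimator\<close>

definition quad_form :: "nat set \<Rightarrow> (nat \<Rightarrow> nat \<Rightarrow> real) \<Rightarrow> (nat \<Rightarrow> real) \<Rightarrow> real" where
  "quad_form S M x = (\<Sum>i\<in>S. \<Sum>j\<in>S. M i j * x i * x j)"

text \<open>Both sides are the squared length of the transpose of \<open>A\<close> applied to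
  \<open>\<theta>\<close>, that is, the variance of the signal-noise term.\<close>

lemma sum_power2_gram:
  "(\<Sum>k<d. (\<Sum>i<d. \<theta> i * A i k)\<^sup>2) = quad_form {..<d} (gram d A) \<theta>"
proof -
  have "(\<Sum>k<d. (\<Sum>i<d. \<theta> i * A i k)\<^sup>2) = (\<Sum>k<d. \<Sum>i<d. \<Sum>j<d. \<theta> i * A i k * (\<theta> j * A j k))"
    by (simp add: power2_eq_square sum_product)
  also have "\<dots> = (\<Sum>i<d. \<Sum>j<d. \<Sum>k<d. \<theta> i * A i k * (\<theta> j * A j k))"
    by (subst sum.swap, rule sum.cong[OF refl], rule sum.swap)
  also have "\<dots> = quad_form {..<d} (gram d A) \<theta>"
    by (simp add: quad_form_def gram_def sum_distrib_left sum_distrib_right mult_ac)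
  finally show ?thesis .
qed

lemma quad_form_gram_nonneg: "0 \<le> quad_form {..<d} (gram d A) \<theta>"
  unfolding sum_power2_gram[symmetric] by (simp add: sum_nonneg)

lemma
  fixes A :: "nat \<Rightarrow> nat \<Rightarrow> real" and \<theta> :: "nat \<Rightarrow> real" and d :: nat
  defines "L \<equiv> (\<lambda>z. \<Sum>i<d. \<theta> i * (\<Sum>k<d. A i k * z k))"
  shows integrable_signal_noise_sq: "integrable (std_gauss_vec d) (\<lambda>z. (L z)\<^sup>2)"
    and integral_signal_noise_sq_le:
      "(\<integral>z. (L z)\<^sup>2 \<partial>std_gauss_vec d) \<le> 5 * gauss_exp_moment * quad_form {..<d} (gram d A) \<theta>"
proof -
  have L: "L z = (\<Sum>k<d. (\<Sum>i<d. \<theta> i * A i k) * z k)" for z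
    unfolding L_def sum_distrib_left
    by (subst sum.swap) (simp add: sum_distrib_right mult.assoc)
  show "integrable (std_gauss_vec d) (\<lambda>z. (L z)\<^sup>2)"
    unfolding L by (rule integrable_linear_form_power2)
  show "(\<integral>z. (L z)\<^sup>2 \<partial>std_gauss_vec d) \<le> 5 * gauss_exp_moment * quad_form {..<d} (gram d A) \<theta>"
    unfolding L sum_power2_gram[symmetric] by (rule integral_linear_form_power2_le)
qed

lemma square_sum2_le: "((x::real) + y)\<^sup>2 \<le> 2 * (x\<^sup>2 + y\<^sup>2)"
  using zero_le_power2[of "x - y"] by (simp add: power2_sum power2_diff)

lemma square_sum3_le: "((x::real) + y + z)\<^sup>2 \<le> 3 * (x\<^sup>2 + y\<^sup>2 + z\<^sup>2)"
  using zero_le_power2[of "x - y"] zero_le_power2[of "x - z"] zero_le_power2[of "y - z"]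
  by (simp add: power2_eq_square algebra_simps)

text \<open>The result is a dominating integrable \<open>B\<close> instead of a risk bound, because
  the risks of \<open>Qhat\<close> and \<open>Nhat\<close> are both read off from it. Without
  thresholding, the error is exactly \<open>2 \<sigma> L + \<sigma>^2 W\<close>, a linear and a
  centred quadratic noise term.\<close>

lemma Qhat_dominated_dense:
  fixes A :: "nat \<Rightarrow> nat \<Rightarrow> real" and \<theta> :: "nat \<Rightarrow> real"
  assumes s: "frob d (gram d A) < real s"
  shows "\<exists>B. integrable (std_gauss_vec d) B \<and>
    (\<forall>z. (Qhat d s \<sigma> (gram d A) (\<lambda>i. \<theta> i + \<sigma> * (\<Sum>k<d. A i k * z k)) - sqnorm d \<theta>)\<^sup>2 \<le> B z) \<and>
    (\<integral>z. B z \<partial>std_gauss_vec d) \<le> 40 * gauss_exp_moment * (\<sigma>\<^sup>2 * quad_form {..<d} (gram d A) \<theta>)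
       + 30000 * gauss_exp_moment\<^sup>2 * (\<sigma> ^ 4 * (psi d s (gram d A))\<^sup>2)"
proof -
  define e where "e i z = (\<Sum>k<d. A i k * z k)" for i and z :: "nat \<Rightarrow> real"
  define g where "g i = gram d A i i" for i
  define L where "L z = (\<Sum>i<d. \<theta> i * e i z)" for z
  define W where "W z = (\<Sum>i<d. g i * ((e i z / sqrt (g i))\<^sup>2 - 1))" for z
  have Wi: "integrable (std_gauss_vec d) (\<lambda>z. (W z)\<^sup>2)"
    and WE: "(\<integral>z. (W z)\<^sup>2 \<partial>std_gauss_vec d) \<le> 600 * gauss_exp_moment\<^sup>2 * 5\<^sup>2 * (frob d (gram d A))\<^sup>2"
    using integrable_gauss_noise_sq[OF _ abs_square_minus_1_le integral_std_gauss_square_minus_1 order_refl, of d A]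
      integral_gauss_noise_sq_le[OF _ abs_square_minus_1_le integral_std_gauss_square_minus_1 order_refl, of d A]
    by (simp_all add: W_def e_def g_def)
  have Li: "integrable (std_gauss_vec d) (\<lambda>z. (L z)\<^sup>2)"
    and LE: "(\<integral>z. (L z)\<^sup>2 \<partial>std_gauss_vec d) \<le> 5 * gauss_exp_moment * quad_form {..<d} (gram d A) \<theta>"
    unfolding L_def e_def by (rule integrable_signal_noise_sq integral_signal_noise_sq_le)+
  \<comment> \<open>For \<open>g i = 0\<close> the noise \<open>e i z\<close> is itself zero, so the
    standardised form agrees despite the division by \<open>sqrt 0\<close>.\<close>
  have ge: "g i * ((e i z / sqrt (g i))\<^sup>2 - 1) = (e i z)\<^sup>2 - g i" for i z
  proof (cases "g i = 0")
    case True
    then have "e i z = 0" using gram_diag_eq_0[of d A i] by (simp add: g_def e_def)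
    with True show ?thesis by simp
  next
    case False
    then have "0 < g i" using gram_diag_nonneg[of d A i] by (simp add: g_def less_le)
    then show ?thesis by (simp add: power_divide right_diff_distrib)
  qed
  have Q: "Qhat d s \<sigma> (gram d A) (\<lambda>i. \<theta> i + \<sigma> * e i z) - sqnorm d \<theta> = 2 * \<sigma> * L z + \<sigma>\<^sup>2 * W z" for z
  proof -
    have "Qhat d s \<sigma> (gram d A) (\<lambda>i. \<theta> i + \<sigma> * e i z) - sqnorm d \<theta>
        = (\<Sum>i<d. (\<theta> i + \<sigma> * e i z)\<^sup>2 - \<sigma>\<^sup>2 * g i - (\<theta> i)\<^sup>2)"
      using s by (simp add: Qhat_def sqnorm_def sum_subtractf g_def)
    also have "\<dots> = (\<Sum>i<d. 2 * \<sigma> * (\<theta> i * e i z) + \<sigma>\<^sup>2 * (g i * ((e i z / sqrt (g i))\<^sup>2 - 1)))"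
      unfolding ge by (intro sum.cong) (auto simp: power2_eq_square algebra_simps)
    also have "\<dots> = 2 * \<sigma> * L z + \<sigma>\<^sup>2 * W z"
      by (simp add: L_def W_def sum.distrib sum_distrib_left)
    finally show ?thesis .
  qed
  let ?B = "\<lambda>z. 8 * \<sigma>\<^sup>2 * (L z)\<^sup>2 + 2 * \<sigma> ^ 4 * (W z)\<^sup>2"
  have "integrable (std_gauss_vec d) ?B" using Li Wi by simp
  moreover have "(Qhat d s \<sigma> (gram d A) (\<lambda>i. \<theta> i + \<sigma> * e i z) - sqnorm d \<theta>)\<^sup>2 \<le> ?B z" for z
    unfolding Q using square_sum2_le[of "2 * \<sigma> * L z" "\<sigma>\<^sup>2 * W z"]
    by (simp add: power_mult_distrib)
  moreover have "(\<integral>z. ?B z \<partial>std_gauss_vec d) \<le> 40 * gauss_exp_moment * (\<sigma>\<^sup>2 * quad_form {..<d} (gram d A) \<theta>)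
       + 30000 * gauss_exp_moment\<^sup>2 * (\<sigma> ^ 4 * (psi d s (gram d A))\<^sup>2)"
  proof -
    have "(\<integral>z. ?B z \<partial>std_gauss_vec d)
        = 8 * \<sigma>\<^sup>2 * (\<integral>z. (L z)\<^sup>2 \<partial>std_gauss_vec d) + 2 * \<sigma> ^ 4 * (\<integral>z. (W z)\<^sup>2 \<partial>std_gauss_vec d)"
      using Li Wi by simp
    also have "\<dots> \<le> 8 * \<sigma>\<^sup>2 * (5 * gauss_exp_moment * quad_form {..<d} (gram d A) \<theta>)
        + 2 * \<sigma> ^ 4 * (600 * gauss_exp_moment\<^sup>2 * 5\<^sup>2 * (frob d (gram d A))\<^sup>2)"
      using LE WE by (intro add_mono mult_left_mono) auto
    also have "\<dots> = 40 * gauss_exp_moment * (\<sigma>\<^sup>2 * quad_form {..<d} (gram d A) \<theta>)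
       + 30000 * gauss_exp_moment\<^sup>2 * (\<sigma> ^ 4 * (psi d s (gram d A))\<^sup>2)"
      using s by (simp add: psi_def)
    finally show ?thesis .
  qed
  ultimately show ?thesis unfolding e_def by blast
qed

text \<open>In the sparse regime the logarithm is bounded below by an absolute constant. Hence
  \<open>s\<close> is at most twice the rate and the threshold is at least 1.\<close>

lemma
  assumes s: "1 \<le> s" "real s \<le> F"
  shows ln_ratio_ge_half: "1 / 2 \<le> ln (1 + F\<^sup>2 / (real s)\<^sup>2)"
    and ratio_ge_1: "1 \<le> F\<^sup>2 / (real s)\<^sup>2"
proof -
  have "(real s)\<^sup>2 \<le> F\<^sup>2" using s by (intro power_mono) auto
  then show r: "1 \<le> F\<^sup>2 / (real s)\<^sup>2" using s by (simp add: le_divide_eq)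
  then have "ln 2 \<le> ln (1 + F\<^sup>2 / (real s)\<^sup>2)" by simp
  then show "1 / 2 \<le> ln (1 + F\<^sup>2 / (real s)\<^sup>2)" using ln2_ge_two_thirds by linarith
qed

text \<open>Coordinates off the support give the centred noise sum \<open>W\<close>. On the support,
  a summand differs from its signal and linear parts by at most \<open>\<sigma>^2 (e^2 + b)\<close>,
  with \<open>e\<close> the noise of that coordinate, and there are at most \<open>s\<close> such
  coordinates, which keeps their total at the order of the rate.\<close>

lemma Qhat_dominated_sparse:
  fixes A :: "nat \<Rightarrow> nat \<Rightarrow> real" and \<theta> :: "nat \<Rightarrow> real"
  assumes s: "1 \<le> s" "real s \<le> frob d (gram d A)" and \<sigma>: "0 < \<sigma>"
    and l0: "l0 d \<theta> \<le> s" and diag: "\<And>i. i < d \<Longrightarrow> gram d A i i \<le> 1"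
  shows "\<exists>B. integrable (std_gauss_vec d) B \<and>
    (\<forall>z. (Qhat d s \<sigma> (gram d A) (\<lambda>i. \<theta> i + \<sigma> * (\<Sum>k<d. A i k * z k)) - sqnorm d \<theta>)\<^sup>2 \<le> B z) \<and>
    (\<integral>z. B z \<partial>std_gauss_vec d) \<le> 60 * gauss_exp_moment * (\<sigma>\<^sup>2 * quad_form {..<d} (gram d A) \<theta>)
       + (600 * gauss_exp_moment + 486 * (tail_const + 1)\<^sup>2 + 460800 * gauss_exp_moment\<^sup>2 * tail_const\<^sup>2)
         * (\<sigma> ^ 4 * (psi d s (gram d A))\<^sup>2)"
proof -
  let ?F = "frob d (gram d A)" and ?J = gauss_exp_moment and ?P = "std_gauss_vec d"
  define l where "l = ln (1 + ?F\<^sup>2 / (real s)\<^sup>2)"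
  define t where "t = tau d s (gram d A)"
  define \<beta> where "\<beta> = cond_second_moment t"
  define b where "b = \<beta> + t\<^sup>2"
  define D where "D = 8 * tail_const * exp (- t\<^sup>2 / 18)"
  define e where "e i z = (\<Sum>k<d. A i k * z k)" for i and z :: "nat \<Rightarrow> real"
  define g where "g i = gram d A i i" for i
  define S where "S = {i. i < d \<and> \<theta> i \<noteq> 0}"
  define T where "T = {i. i < d \<and> \<theta> i = 0}"
  define L where "L z = (\<Sum>i<d. \<theta> i * e i z)" for z
  define W where "W z = (\<Sum>i\<in>T. g i * thr_sq t (e i z / sqrt (g i)))" for z
  define R where "R i z = (if \<bar>\<theta> i + \<sigma> * e i z\<bar> > \<sigma> * sqrt (g i) * t
      then (\<theta> i + \<sigma> * e i z)\<^sup>2 - \<sigma>\<^sup>2 * g i * \<beta> else 0)" for i z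
  have g0: "0 \<le> g i" for i by (simp add: g_def gram_diag_nonneg)
  have l: "1 / 2 \<le> l" unfolding l_def by (rule ln_ratio_ge_half[OF s])
  have t2: "t\<^sup>2 = 9 * l" using l by (simp add: t_def tau_def l_def power_mult_distrib)
  have t1: "1 \<le> t"
  proof -
    have "1\<^sup>2 \<le> t\<^sup>2" using l by (simp add: t2)
    moreover have "0 \<le> t" using l by (simp add: t_def tau_def l_def)
    ultimately show ?thesis by (rule power2_le_imp_le)
  qed
  have \<psi>: "psi d s (gram d A) = real s * l" using s by (simp add: psi_def l_def)
  have b: "0 \<le> b" "b \<le> 9 * (tail_const + 1) * l"
    using cond_second_moment_nonneg[OF t1] cond_second_moment_le[OF t1] l
    by (simp_all add: b_def \<beta>_def t2 algebra_simps)
  have cS: "card S \<le> s" using l0 by (simp add: l0_def S_def)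
  have fin: "finite S" "finite T" "S \<subseteq> {..<d}" "T \<subseteq> {..<d}" "S \<inter> T = {}" "{..<d} = S \<union> T"
    by (auto simp: S_def T_def)
  note thr = borel_measurable_thr_sq thr_sq_bound[OF t1] integral_thr_sq[OF t1] fin(4)
  have Wi: "integrable ?P (\<lambda>z. (W z)\<^sup>2)"
    and WE: "(\<integral>z. (W z)\<^sup>2 \<partial>?P) \<le> 600 * ?J\<^sup>2 * D\<^sup>2 * ?F\<^sup>2"
    unfolding W_def e_def g_def D_def
    by (rule integrable_gauss_noise_sq[OF thr] integral_gauss_noise_sq_le[OF thr])+
  have Li: "integrable ?P (\<lambda>z. (L z)\<^sup>2)"
    and LE: "(\<integral>z. (L z)\<^sup>2 \<partial>?P) \<le> 5 * ?J * quad_form {..<d} (gram d A) \<theta>"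
    unfolding L_def e_def by (rule integrable_signal_noise_sq integral_signal_noise_sq_le)+
  have ei: "integrable ?P (\<lambda>z. (e i z) ^ 4)" for i
    unfolding e_def by (rule integrable_linear_form_power4)
  have eE: "(\<integral>z. (e i z) ^ 4 \<partial>?P) \<le> 25 * ?J" if "i \<in> S" for i
  proof -
    have "(\<integral>z. (e i z) ^ 4 \<partial>?P) \<le> 25 * ?J * (g i)\<^sup>2"
      using integral_linear_form_power4_le[where c="A i" and d=d] by (simp add: e_def g_def gram_diag)
    also have "\<dots> \<le> 25 * ?J * 1"
      using that diag[of i] g0[of i] gauss_exp_moment_ge_1
      by (intro mult_left_mono) (auto simp: g_def S_def power_le_one_iff)
    finally show ?thesis by simp
  qed
  \<comment> \<open>Without signal, the threshold test is invariant under dividing by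
    \<open>\<sigma> * sqrt (g i)\<close>, which turns the summand into a standardised
    \<open>thr_sq\<close>. If \<open>g i = 0\<close>, both sides are zero.\<close>
  have RT: "R i z = \<sigma>\<^sup>2 * (g i * thr_sq t (e i z / sqrt (g i)))" if "i \<in> T" for i z
  proof (cases "g i = 0")
    case True
    then have "e i z = 0" using gram_diag_eq_0[of d A i] by (simp add: g_def e_def)
    with True that show ?thesis by (simp add: R_def T_def)
  next
    case False
    then have gp: "0 < g i" using g0[of i] by simp
    have "\<sigma> * sqrt (g i) * t < \<bar>\<sigma> * e i z\<bar> \<longleftrightarrow> t < \<bar>e i z / sqrt (g i)\<bar>"
      using gp \<sigma> by (simp add: abs_mult less_divide_eq mult_ac)
    then show ?thesis
      using that gp by (simp add: R_def T_def thr_sq_def \<beta>_def power_mult_distrib power_divide right_diff_distrib)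
  qed
  have RS: "\<bar>R i z - (\<theta> i)\<^sup>2 - 2 * \<sigma> * (\<theta> i * e i z)\<bar> \<le> \<sigma>\<^sup>2 * ((e i z)\<^sup>2 + b)" if "i \<in> S" for i z
  proof -
    have g1: "g i \<le> 1" using that diag[of i] by (simp add: g_def S_def)
    have sq: "(\<theta> i + \<sigma> * e i z)\<^sup>2 = (\<theta> i)\<^sup>2 + 2 * \<sigma> * (\<theta> i * e i z) + \<sigma>\<^sup>2 * (e i z)\<^sup>2"
      by (simp add: power2_eq_square algebra_simps)
    have \<beta>0: "0 \<le> \<beta>" unfolding \<beta>_def by (rule cond_second_moment_nonneg[OF t1])
    have "g i * \<beta> \<le> 1 * \<beta>" "g i * t\<^sup>2 \<le> 1 * t\<^sup>2" using g1 \<beta>0 by (intro mult_right_mono; simp)+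
    then have gb: "\<sigma>\<^sup>2 * (g i * \<beta>) \<le> \<sigma>\<^sup>2 * \<beta>" "\<sigma>\<^sup>2 * (g i * t\<^sup>2) \<le> \<sigma>\<^sup>2 * t\<^sup>2"
      by (intro mult_left_mono; simp)+
    have nn: "0 \<le> \<sigma>\<^sup>2 * (g i * \<beta>)" "0 \<le> \<sigma>\<^sup>2 * (e i z)\<^sup>2" "0 \<le> \<sigma>\<^sup>2 * \<beta>" "0 \<le> \<sigma>\<^sup>2 * t\<^sup>2"
      using g0[of i] \<beta>0 by auto
    have eb: "\<sigma>\<^sup>2 * ((e i z)\<^sup>2 + b) = \<sigma>\<^sup>2 * (e i z)\<^sup>2 + \<sigma>\<^sup>2 * \<beta> + \<sigma>\<^sup>2 * t\<^sup>2"
      by (simp add: b_def algebra_simps)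
    show ?thesis
    proof (cases "\<bar>\<theta> i + \<sigma> * e i z\<bar> > \<sigma> * sqrt (g i) * t")
      case True
      then have "R i z - (\<theta> i)\<^sup>2 - 2 * \<sigma> * (\<theta> i * e i z) = \<sigma>\<^sup>2 * (e i z)\<^sup>2 - \<sigma>\<^sup>2 * (g i * \<beta>)"
        by (simp add: R_def sq)
      then show ?thesis using gb nn unfolding eb by (simp only: abs_le_iff) linarith
    next
      case False
      \<comment> \<open>A suppressed coordinate loses the whole square of
        \<open>\<theta> i + \<sigma> * e i z\<close>, which the failed test itself bounds by the
        squared threshold.\<close>
      then have "\<bar>\<theta> i + \<sigma> * e i z\<bar>\<^sup>2 \<le> (\<sigma> * sqrt (g i) * t)\<^sup>2"
        by (intro power_mono) auto
      then have "(\<theta> i + \<sigma> * e i z)\<^sup>2 \<le> \<sigma>\<^sup>2 * (g i * t\<^sup>2)"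
        using g0[of i] by (simp add: power_mult_distrib)
      moreover have "R i z - (\<theta> i)\<^sup>2 - 2 * \<sigma> * (\<theta> i * e i z) = \<sigma>\<^sup>2 * (e i z)\<^sup>2 - (\<theta> i + \<sigma> * e i z)\<^sup>2"
        using False by (simp add: R_def sq)
      ultimately show ?thesis
        using gb nn zero_le_power2[of "\<theta> i + \<sigma> * e i z"] unfolding eb by (simp only: abs_le_iff) linarith
    qed
  qed
  let ?Q = "\<lambda>z. Qhat d s \<sigma> (gram d A) (\<lambda>i. \<theta> i + \<sigma> * e i z) - sqnorm d \<theta>"
  define U where "U z = (\<Sum>i\<in>S. R i z - (\<theta> i)\<^sup>2 - 2 * \<sigma> * (\<theta> i * e i z))" for z
  have Q: "?Q z = 2 * \<sigma> * L z + U z + \<sigma>\<^sup>2 * W z" for z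
  proof -
    have "?Q z - 2 * \<sigma> * L z = (\<Sum>i<d. R i z - (\<theta> i)\<^sup>2 - 2 * \<sigma> * (\<theta> i * e i z))"
      using s by (simp add: Qhat_def sqnorm_def sum_subtractf R_def L_def sum_distrib_left g_def t_def \<beta>_def
          cong: if_cong)
    also have "\<dots> = U z + (\<Sum>i\<in>T. R i z - (\<theta> i)\<^sup>2 - 2 * \<sigma> * (\<theta> i * e i z))"
      unfolding fin(6) U_def by (rule sum.union_disjoint[OF fin(1,2,5)])
    also have "(\<Sum>i\<in>T. R i z - (\<theta> i)\<^sup>2 - 2 * \<sigma> * (\<theta> i * e i z)) = \<sigma>\<^sup>2 * W z"
      unfolding W_def sum_distrib_left by (intro sum.cong) (auto simp: RT, auto simp: T_def)
    finally show ?thesis by simp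
  qed
  have U: "(U z)\<^sup>2 \<le> \<sigma> ^ 4 * (real s * (\<Sum>i\<in>S. 2 * (e i z) ^ 4 + 2 * b\<^sup>2))" for z
  proof -
    have "\<bar>U z\<bar> \<le> (\<Sum>i\<in>S. \<sigma>\<^sup>2 * ((e i z)\<^sup>2 + b))"
      unfolding U_def by (rule order_trans[OF sum_abs]) (intro sum_mono RS)
    \<comment> \<open>The inserted factor 1 puts the sum in the form of the Cauchy-Schwarz
      inequality, whose first factor is then \<open>card S\<close>, at most
      \<open>s\<close>.\<close>
    then have "(U z)\<^sup>2 \<le> (\<Sum>i\<in>S. 1 * (\<sigma>\<^sup>2 * ((e i z)\<^sup>2 + b)))\<^sup>2"
      using power_mono[of "\<bar>U z\<bar>" _ 2] by simp
    also have "\<dots> \<le> (\<Sum>i\<in>S. 1\<^sup>2) * (\<Sum>i\<in>S. (\<sigma>\<^sup>2 * ((e i z)\<^sup>2 + b))\<^sup>2)"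
      by (rule Cauchy_Schwarz_ineq_sum)
    also have "\<dots> \<le> real s * (\<Sum>i\<in>S. \<sigma> ^ 4 * (2 * (e i z) ^ 4 + 2 * b\<^sup>2))"
    proof (intro mult_mono sum_mono sum_nonneg)
      show "(\<Sum>i\<in>S. 1\<^sup>2) \<le> real s" using cS by simp
      fix i
      have "(\<sigma>\<^sup>2 * ((e i z)\<^sup>2 + b))\<^sup>2 = \<sigma> ^ 4 * ((e i z)\<^sup>2 + b)\<^sup>2" by (simp add: power_mult_distrib)
      also have "\<dots> \<le> \<sigma> ^ 4 * (2 * (e i z) ^ 4 + 2 * b\<^sup>2)"
        using square_sum2_le[of "(e i z)\<^sup>2" b] by (intro mult_left_mono) auto
      finally show "(\<sigma>\<^sup>2 * ((e i z)\<^sup>2 + b))\<^sup>2 \<le> \<sigma> ^ 4 * (2 * (e i z) ^ 4 + 2 * b\<^sup>2)" .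
    qed auto
    finally show ?thesis by (simp add: sum_distrib_left mult_ac)
  qed
  let ?B = "\<lambda>z. 12 * \<sigma>\<^sup>2 * (L z)\<^sup>2 + 3 * \<sigma> ^ 4 * real s * (\<Sum>i\<in>S. 2 * (e i z) ^ 4 + 2 * b\<^sup>2) + 3 * \<sigma> ^ 4 * (W z)\<^sup>2"
  have Pc: "integrable ?P (\<lambda>_. c)" "(\<integral>z. c \<partial>?P) = c" for c :: real
  proof -
    interpret prob_space ?P unfolding std_gauss_vec_def by (rule prob_space_PiM) (rule prob_space_std_gauss)
    show "integrable ?P (\<lambda>_. c)" "(\<integral>z. c \<partial>?P) = c" by (simp_all add: prob_space)
  qed
  have Si: "integrable ?P (\<lambda>z. \<Sum>i\<in>S. 2 * (e i z) ^ 4 + 2 * b\<^sup>2)"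
    by (intro Bochner_Integration.integrable_sum Bochner_Integration.integrable_add integrable_mult_right ei Pc)
  have "integrable ?P ?B" using Li Wi Si by simp
  moreover have "(?Q z)\<^sup>2 \<le> ?B z" for z
  proof -
    have "(?Q z)\<^sup>2 \<le> 3 * ((2 * \<sigma> * L z)\<^sup>2 + (U z)\<^sup>2 + (\<sigma>\<^sup>2 * W z)\<^sup>2)"
      unfolding Q by (rule square_sum3_le)
    also have "\<dots> \<le> 3 * ((2 * \<sigma> * L z)\<^sup>2 + \<sigma> ^ 4 * (real s * (\<Sum>i\<in>S. 2 * (e i z) ^ 4 + 2 * b\<^sup>2)) + (\<sigma>\<^sup>2 * W z)\<^sup>2)"
      using U[of z] by simp
    also have "\<dots> = ?B z" by (simp add: power_mult_distrib algebra_simps)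
    finally show ?thesis .
  qed
  moreover have "(\<integral>z. ?B z \<partial>?P) \<le> 60 * ?J * (\<sigma>\<^sup>2 * quad_form {..<d} (gram d A) \<theta>)
       + (600 * ?J + 486 * (tail_const + 1)\<^sup>2 + 460800 * ?J\<^sup>2 * tail_const\<^sup>2)
         * (\<sigma> ^ 4 * (psi d s (gram d A))\<^sup>2)"
  proof -
    have SE: "(\<integral>z. (\<Sum>i\<in>S. 2 * (e i z) ^ 4 + 2 * b\<^sup>2) \<partial>?P) \<le> real s * (50 * ?J + 2 * b\<^sup>2)"
    proof -
      have "(\<integral>z. (\<Sum>i\<in>S. 2 * (e i z) ^ 4 + 2 * b\<^sup>2) \<partial>?P) = (\<Sum>i\<in>S. 2 * (\<integral>z. (e i z) ^ 4 \<partial>?P) + 2 * b\<^sup>2)"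
        using ei Pc(1) Pc(2)[of 1] by (simp add: Bochner_Integration.integral_sum)
      also have "\<dots> \<le> (\<Sum>i\<in>S. 50 * ?J + 2 * b\<^sup>2)"
        using eE by (intro sum_mono) fastforce
      also have "\<dots> \<le> real s * (50 * ?J + 2 * b\<^sup>2)"
        using cS gauss_exp_moment_ge_1 by (simp add: mult_right_mono)
      finally show ?thesis .
    qed
    \<comment> \<open>Here the factor 3 in \<open>tau\<close> is used: \<open>t^2 / 9 = l\<close>,
      so squaring the threshold gain gives \<open>exp (- l) = 1 / (1 + q)\<close> with
      \<open>q = F^2 / s^2\<close>, and \<open>q / (1 + q) <= 1\<close> leaves only
      \<open>s^2\<close>.\<close>
    have D2: "D\<^sup>2 * ?F\<^sup>2 \<le> 64 * tail_const\<^sup>2 * (real s)\<^sup>2"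
    proof -
      define q where "q = ?F\<^sup>2 / (real s)\<^sup>2"
      have q: "1 \<le> q" unfolding q_def by (rule ratio_ge_1[OF s])
      have "exp (- t\<^sup>2 / 18) ^ 2 = exp (- l)"
        unfolding t2 by (simp add: power2_eq_square exp_add[symmetric])
      also have "\<dots> = 1 / (1 + q)"
        unfolding l_def q_def[symmetric] using q by (simp add: exp_minus inverse_eq_divide)
      finally have "D\<^sup>2 = 64 * tail_const\<^sup>2 * (1 / (1 + q))"
        by (simp add: D_def power_mult_distrib)
      moreover have "?F\<^sup>2 = q * (real s)\<^sup>2" using s by (simp add: q_def)
      ultimately have "D\<^sup>2 * ?F\<^sup>2 = 64 * tail_const\<^sup>2 * (real s)\<^sup>2 * (q / (1 + q))"
        by simp
      also have "\<dots> \<le> 64 * tail_const\<^sup>2 * (real s)\<^sup>2 * 1"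
        using q by (intro mult_left_mono) auto
      finally show ?thesis by simp
    qed
    have s2: "(real s)\<^sup>2 \<le> 4 * (real s * l)\<^sup>2"
    proof -
      have "(real s)\<^sup>2 \<le> (2 * (real s * l))\<^sup>2"
        using l mult_left_mono[of "1/2" l "real s"] by (intro power_mono) auto
      then show ?thesis by (simp add: power_mult_distrib)
    qed
    have sb: "(real s)\<^sup>2 * b\<^sup>2 \<le> 81 * (tail_const + 1)\<^sup>2 * (real s * l)\<^sup>2"
    proof -
      have "b\<^sup>2 \<le> (9 * (tail_const + 1) * l)\<^sup>2" using b by (intro power_mono) auto
      then have "(real s)\<^sup>2 * b\<^sup>2 \<le> (real s)\<^sup>2 * (9 * (tail_const + 1) * l)\<^sup>2"
        by (intro mult_left_mono) auto
      also have "\<dots> = 81 * (tail_const + 1)\<^sup>2 * (real s * l)\<^sup>2"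
        unfolding power_mult_distrib by simp
      finally show ?thesis .
    qed
    have "(\<integral>z. ?B z \<partial>?P) = 12 * \<sigma>\<^sup>2 * (\<integral>z. (L z)\<^sup>2 \<partial>?P)
        + 3 * \<sigma> ^ 4 * real s * (\<integral>z. (\<Sum>i\<in>S. 2 * (e i z) ^ 4 + 2 * b\<^sup>2) \<partial>?P) + 3 * \<sigma> ^ 4 * (\<integral>z. (W z)\<^sup>2 \<partial>?P)"
      using Li Wi Si by (simp only: Bochner_Integration.integral_add Bochner_Integration.integrable_add
          integrable_mult_right integral_mult_right_zero)
    also have "\<dots> \<le> 12 * \<sigma>\<^sup>2 * (5 * ?J * quad_form {..<d} (gram d A) \<theta>)
        + 3 * \<sigma> ^ 4 * real s * (real s * (50 * ?J + 2 * b\<^sup>2)) + 3 * \<sigma> ^ 4 * (600 * ?J\<^sup>2 * D\<^sup>2 * ?F\<^sup>2)"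
      using LE WE SE by (intro add_mono mult_left_mono) auto
    also have "\<dots> = 60 * ?J * (\<sigma>\<^sup>2 * quad_form {..<d} (gram d A) \<theta>)
        + \<sigma> ^ 4 * (150 * ?J * (real s)\<^sup>2 + 6 * ((real s)\<^sup>2 * b\<^sup>2) + 1800 * ?J\<^sup>2 * (D\<^sup>2 * ?F\<^sup>2))"
      by (simp add: power2_eq_square algebra_simps)
    \<comment> \<open>The constants of the statement are \<open>150 * 4\<close>,
      \<open>6 * 81\<close> and \<open>1800 * 64 * 4\<close>; the factors 4 convert
      \<open>s^2\<close> into \<open>(s l)^2\<close>.\<close>
    also have "\<dots> \<le> 60 * ?J * (\<sigma>\<^sup>2 * quad_form {..<d} (gram d A) \<theta>)
        + \<sigma> ^ 4 * (150 * ?J * (4 * (real s * l)\<^sup>2) + 6 * (81 * (tail_const + 1)\<^sup>2 * (real s * l)\<^sup>2)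
           + 1800 * ?J\<^sup>2 * (64 * tail_const\<^sup>2 * (4 * (real s * l)\<^sup>2)))"
    proof -
      have "64 * tail_const\<^sup>2 * (real s)\<^sup>2 \<le> 64 * tail_const\<^sup>2 * (4 * (real s * l)\<^sup>2)"
        using s2 by (intro mult_left_mono) auto
      with D2 have "D\<^sup>2 * ?F\<^sup>2 \<le> 64 * tail_const\<^sup>2 * (4 * (real s * l)\<^sup>2)" by (rule order_trans)
      then show ?thesis
        using s2 sb gauss_exp_moment_ge_1 by (intro add_mono mult_left_mono order_refl) auto
    qed
    also have "\<dots> = 60 * ?J * (\<sigma>\<^sup>2 * quad_form {..<d} (gram d A) \<theta>)
       + (600 * ?J + 486 * (tail_const + 1)\<^sup>2 + 460800 * ?J\<^sup>2 * tail_const\<^sup>2) * (\<sigma> ^ 4 * (psi d s (gram d A))\<^sup>2)"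
      unfolding \<psi> by (simp add: algebra_simps)
    finally show ?thesis .
  qed
  ultimately show ?thesis unfolding e_def by blast
qed

section \<open>Rayleigh quotients and the largest eigenvalue\<close>

lemma quad_form_eq_sum: "quad_form S M x = (\<Sum>i\<in>S. x i * (\<Sum>j\<in>S. M i j * x j))"
  by (simp add: quad_form_def sum_distrib_left mult_ac)

text \<open>Bessel's inequality for a coordinate vector: \<open>w\<close> is its projection onto the
  span of the orthonormal family, and both the squared length of \<open>w\<close> and its inner
  product with the coordinate vector equal the left-hand sum.\<close>

lemma bessel_coordinate:
  fixes v :: "'k \<Rightarrow> 'i \<Rightarrow> real"
  assumes S: "finite S" "i \<in> S" and K: "finite K"
    and orth: "\<And>k l. k \<in> K \<Longrightarrow> l \<in> K \<Longrightarrow> (\<Sum>j\<in>S. v k j * v l j) = (if k = l then 1 else 0)"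
  shows "(\<Sum>k\<in>K. (v k i)\<^sup>2) \<le> 1"
proof -
  define \<delta> where "\<delta> j = (if j = i then 1 else 0 :: real)" for j
  define w where "w j = (\<Sum>k\<in>K. v k i * v k j)" for j
  have "0 \<le> (\<Sum>j\<in>S. (\<delta> j - w j)\<^sup>2)" by (simp add: sum_nonneg)
  also have "\<dots> = (\<Sum>j\<in>S. \<delta> j * \<delta> j) - 2 * (\<Sum>j\<in>S. \<delta> j * w j) + (\<Sum>j\<in>S. w j * w j)"
    by (simp add: power2_eq_square algebra_simps sum.distrib sum_subtractf sum_distrib_left)
  also have "(\<Sum>j\<in>S. \<delta> j * \<delta> j) = 1"
    using S by (simp add: \<delta>_def if_distrib sum.delta cong: if_cong)
  also have "(\<Sum>j\<in>S. \<delta> j * w j) = w i"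
  proof -
    have "(\<Sum>j\<in>S. \<delta> j * w j) = (\<Sum>j\<in>S. if j = i then w j else 0)"
      by (intro sum.cong) (auto simp: \<delta>_def)
    then show ?thesis using S by (simp add: sum.delta)
  qed
  also have "(\<Sum>j\<in>S. w j * w j) = w i"
  proof -
    have "(\<Sum>j\<in>S. w j * w j) = (\<Sum>j\<in>S. \<Sum>k\<in>K. \<Sum>l\<in>K. v k i * v l i * (v k j * v l j))"
      by (simp add: w_def sum_product mult_ac)
    also have "\<dots> = (\<Sum>k\<in>K. \<Sum>j\<in>S. \<Sum>l\<in>K. v k i * v l i * (v k j * v l j))"
      by (rule sum.swap)
    also have "\<dots> = (\<Sum>k\<in>K. \<Sum>l\<in>K. \<Sum>j\<in>S. v k i * v l i * (v k j * v l j))"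
      by (rule sum.cong[OF refl], rule sum.swap)
    also have "\<dots> = (\<Sum>k\<in>K. \<Sum>l\<in>K. v k i * v l i * (if k = l then 1 else 0))"
      by (intro sum.cong refl) (simp only: sum_distrib_left[symmetric] orth)
    also have "\<dots> = (\<Sum>k\<in>K. v k i * v k i)"
    proof (rule sum.cong[OF refl])
      fix k assume "k \<in> K"
      have "(\<Sum>l\<in>K. v k i * v l i * (if k = l then 1 else 0)) = (\<Sum>l\<in>K. if k = l then v k i * v l i else 0)"
        by (intro sum.cong) auto
      then show "(\<Sum>l\<in>K. v k i * v l i * (if k = l then 1 else 0)) = v k i * v k i"
        using K \<open>k \<in> K\<close> by simp
    qed
    finally show ?thesis by (simp add: w_def)
  qed
  finally show ?thesis by (simp add: w_def power2_eq_square)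
qed

text \<open>Makes \<open>Max\<close> in \<open>lambda_max\<close> range over a finite set.
  Eigenvectors of distinct eigenvalues of a symmetric matrix are orthogonal; after normalisation,
  summing Bessel's inequality over the coordinates bounds their number by
  \<open>card S\<close>.\<close>

lemma finite_eigenvalues_on:
  assumes S: "finite S" and sym: "\<And>i j. M i j = M j i"
  shows "finite {k. is_eigenvalue_on S M k}"
proof (rule ccontr)
  assume "infinite {k. is_eigenvalue_on S M k}"
  then obtain K where K: "K \<subseteq> {k. is_eigenvalue_on S M k}" "finite K" "card K = Suc (card S)"
    using infinite_arbitrarily_large by blast
  have "\<forall>k\<in>K. \<exists>x. (\<exists>i\<in>S. x i \<noteq> 0) \<and> (\<forall>i\<in>S. (\<Sum>j\<in>S. M i j * x j) = k * x i)"
    using K(1) by (auto simp: is_eigenvalue_on_def)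
  then obtain x where x: "\<And>k. k \<in> K \<Longrightarrow> \<exists>i\<in>S. x k i \<noteq> 0"
    and ev: "\<And>k i. k \<in> K \<Longrightarrow> i \<in> S \<Longrightarrow> (\<Sum>j\<in>S. M i j * x k j) = k * x k i"
    by metis
  define n where "n k = sqrt (\<Sum>i\<in>S. (x k i)\<^sup>2)" for k
  define v where "v k i = x k i / n k" for k i
  have n: "0 < n k" "(\<Sum>i\<in>S. (x k i)\<^sup>2) = n k * n k" if k: "k \<in> K" for k
  proof -
    obtain i where "i \<in> S" "x k i \<noteq> 0" using x[OF k] by blast
    then have "0 < (\<Sum>i\<in>S. (x k i)\<^sup>2)" using S by (intro sum_pos2[of S i]) auto
    then show "0 < n k" "(\<Sum>i\<in>S. (x k i)\<^sup>2) = n k * n k" by (auto simp: n_def)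
  qed
  have orth: "(\<Sum>j\<in>S. v k j * v l j) = (if k = l then 1 else 0)" if kl: "k \<in> K" "l \<in> K" for k l
  proof (cases "k = l")
    case True
    have "(\<Sum>j\<in>S. v k j * v k j) = (\<Sum>j\<in>S. (x k j)\<^sup>2) / (n k * n k)"
      by (simp add: v_def power2_eq_square sum_divide_distrib)
    then show ?thesis using n[OF kl(1)] True by simp
  next
    case False
    \<comment> \<open>Symmetry moves \<open>M\<close> across the inner product, so \<open>k\<close>
      and \<open>l\<close> times the same inner product agree.\<close>
    have "k * (\<Sum>j\<in>S. x k j * x l j) = (\<Sum>i\<in>S. (\<Sum>j\<in>S. M i j * x k j) * x l i)"
      using ev[OF kl(1)] by (simp add: sum_distrib_left mult_ac)
    also have "\<dots> = (\<Sum>i\<in>S. \<Sum>j\<in>S. M i j * x k j * x l i)"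
      by (simp add: sum_distrib_right)
    also have "\<dots> = (\<Sum>j\<in>S. \<Sum>i\<in>S. M i j * x k j * x l i)"
      by (rule sum.swap)
    also have "\<dots> = (\<Sum>j\<in>S. (\<Sum>i\<in>S. M j i * x l i) * x k j)"
      unfolding sum_distrib_right by (intro sum.cong refl, subst sym) (simp only: mult_ac)
    also have "\<dots> = l * (\<Sum>j\<in>S. x k j * x l j)"
      using ev[OF kl(2)] by (simp add: sum_distrib_left mult_ac)
    finally have "(\<Sum>j\<in>S. x k j * x l j) = 0" using False by simp
    then show ?thesis
      using False by (simp add: v_def sum_divide_distrib[symmetric])
  qed
  have "real (card K) = (\<Sum>k\<in>K. \<Sum>i\<in>S. (v k i)\<^sup>2)"
    using orth by (simp add: power2_eq_square)
  also have "\<dots> = (\<Sum>i\<in>S. \<Sum>k\<in>K. (v k i)\<^sup>2)"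
    by (rule sum.swap)
  also have "\<dots> \<le> (\<Sum>i\<in>S. 1)"
    by (intro sum_mono bessel_coordinate[OF S _ K(2) orth])
  finally show False using K(3) by simp
qed

text \<open>The form is maximised on the unit sphere of the coordinates in \<open>S\<close>. Padding
  with zeros outside \<open>S\<close> makes it a closed subset of a product of compact sets, hence
  compact in the product topology on functions; homogeneity of degree two extends the bound to all
  \<open>y\<close>.\<close>

lemma rayleigh_maximizer_exists:
  fixes M :: "nat \<Rightarrow> nat \<Rightarrow> real"
  assumes S: "finite S" "S \<noteq> {}"
  obtains x where "(\<Sum>i\<in>S. (x i)\<^sup>2) = 1"
    "\<And>y. quad_form S M y \<le> quad_form S M x * (\<Sum>i\<in>S. (y i)\<^sup>2)"
proof -
  define K where "K = {x :: nat \<Rightarrow> real. (\<Sum>i\<in>S. (x i)\<^sup>2) = 1 \<and> (\<forall>i. i \<notin> S \<longrightarrow> x i = 0)}"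
  define X where "X i = (if i \<in> S then {-1..1} else {0 :: real})" for i
  have "compactin (product_topology (\<lambda>i::nat. euclidean :: real topology) UNIV) (PiE UNIV X)"
    by (subst compactin_PiE) (auto simp: X_def)
  then have cX: "compact (PiE UNIV X)"
    by (simp add: euclidean_product_topology)
  have cont: "continuous_on UNIV (\<lambda>x :: nat \<Rightarrow> real. \<Sum>i\<in>S. (x i)\<^sup>2)"
    by (intro continuous_intros) auto
  have "closed {x :: nat \<Rightarrow> real. (\<Sum>i\<in>S. (x i)\<^sup>2) = 1}"
    using cont by (intro closed_Collect_eq) auto
  then have "compact (PiE UNIV X \<inter> {x. (\<Sum>i\<in>S. (x i)\<^sup>2) = 1})"
    using cX by (rule compact_Int_closed[rotated])
  moreover have "PiE UNIV X \<inter> {x. (\<Sum>i\<in>S. (x i)\<^sup>2) = 1} = K"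
  proof -
    have "x i \<in> {-1..1}" if "(\<Sum>i\<in>S. (x i)\<^sup>2) = 1" "i \<in> S" for x :: "nat \<Rightarrow> real" and i
    proof -
      have "(x i)\<^sup>2 \<le> 1"
        using member_le_sum[of i S "\<lambda>i. (x i)\<^sup>2"] that S by simp
      then show ?thesis by (simp add: abs_square_le_1 abs_le_iff)
    qed
    then show ?thesis
      by (auto simp: K_def X_def PiE_def Pi_def split: if_splits)
  qed
  ultimately have "compact K" by simp
  moreover have "K \<noteq> {}"
  proof -
    obtain i where i: "i \<in> S" using S by blast
    have "(\<Sum>j\<in>S. (if j = i then 1 else 0 :: real)\<^sup>2) = (\<Sum>j\<in>S. if j = i then 1 else 0)"
      by (intro sum.cong) auto
    then have "(\<lambda>j. if j = i then 1 else 0) \<in> K"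
      using i S by (auto simp: K_def)
    then show ?thesis by blast
  qed
  moreover have "continuous_on K (quad_form S M)"
  proof -
    have "continuous_on UNIV (quad_form S M)"
      unfolding quad_form_def by (intro continuous_intros) auto
    then show ?thesis by (rule continuous_on_subset) auto
  qed
  ultimately obtain x where x: "x \<in> K" "\<And>y. y \<in> K \<Longrightarrow> quad_form S M y \<le> quad_form S M x"
    using continuous_attains_sup[of K "quad_form S M"] by blast
  show ?thesis
  proof (rule that[of x])
    show "(\<Sum>i\<in>S. (x i)\<^sup>2) = 1" using x by (simp add: K_def)
    fix y :: "nat \<Rightarrow> real"
    let ?q = "\<Sum>i\<in>S. (y i)\<^sup>2"
    show "quad_form S M y \<le> quad_form S M x * ?q"
    proof (cases "?q = 0")
      case True
      then have "\<And>i. i \<in> S \<Longrightarrow> y i = 0" using S by (simp add: sum_nonneg_eq_0_iff)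
      then show ?thesis using True by (simp add: quad_form_def)
    next
      case False
      then have q: "0 < ?q" by (simp add: sum_nonneg less_le)
      define w where "w i = (if i \<in> S then y i / sqrt ?q else 0)" for i
      have "(\<Sum>i\<in>S. (w i)\<^sup>2) = (\<Sum>i\<in>S. (y i)\<^sup>2 / ?q)"
        using q by (intro sum.cong) (auto simp: w_def power_divide)
      then have "w \<in> K" using q by (simp add: K_def w_def sum_divide_distrib[symmetric])
      then have "quad_form S M w \<le> quad_form S M x" by (rule x)
      moreover have "quad_form S M w = quad_form S M y / ?q"
      proof -
        have "quad_form S M w = (\<Sum>i\<in>S. \<Sum>j\<in>S. M i j * y i * y j / ?q)"
          unfolding quad_form_def using q by (intro sum.cong) (auto simp: w_def)
        then show ?thesis by (simp add: quad_form_def sum_divide_distrib)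
      qed
      ultimately show ?thesis using q by (simp add: divide_le_eq)
    qed
  qed
qed

text \<open>A maximizer of the Rayleigh quotient is an eigenvector: the first-order term of the
  quotient must vanish in every direction.\<close>
lemma quad_form_le_lambda_max:
  fixes M :: "nat \<Rightarrow> nat \<Rightarrow> real"
  assumes S: "finite S" and sym: "\<And>i j. M i j = M j i"
  shows "quad_form S M y \<le> lambda_max S M * (\<Sum>i\<in>S. (y i)\<^sup>2)"
proof (cases "S = {}")
  \<comment> \<open>With no coordinates there is no eigenvalue and \<open>lambda_max\<close> is a
    \<open>Max\<close> over the empty set, but it is multiplied by 0. This covers a zero
    signal.\<close>
  case True
  then show ?thesis by (simp add: quad_form_def)
next
  case False
  obtain x where x1: "(\<Sum>i\<in>S. (x i)\<^sup>2) = 1"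
    and x2: "\<And>y. quad_form S M y \<le> quad_form S M x * (\<Sum>i\<in>S. (y i)\<^sup>2)"
    using rayleigh_maximizer_exists[OF S False] by blast
  let ?k = "quad_form S M x"
  have ev: "(\<Sum>j\<in>S. M i j * x j) = ?k * x i" if i: "i \<in> S" for i
  proof -
    define c where "c = (\<Sum>j\<in>S. M i j * x j) - ?k * x i"
    \<comment> \<open>Maximality of \<open>x\<close> is tested at its perturbation by
      \<open>h\<close> in coordinate \<open>i\<close>; after subtracting the maximum times the
      squared length, only the terms of first and second order in \<open>h\<close> remain.\<close>
    have key: "2 * h * c + h\<^sup>2 * (M i i - ?k) \<le> 0" for h
    proof -
      define y where "y j = x j + h * (if j = i then 1 else 0)" for j
      have d1: "(\<Sum>j\<in>S. f j * (if j = i then 1 else 0)) = f i" for f :: "nat \<Rightarrow> real"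
      proof -
        have "(\<Sum>j\<in>S. f j * (if j = i then 1 else 0)) = (\<Sum>j\<in>S. if j = i then f j else 0)"
          by (intro sum.cong) auto
        then show ?thesis using i S by simp
      qed
      have My: "(\<Sum>k\<in>S. M j k * y k) = (\<Sum>k\<in>S. M j k * x k) + h * M j i" for j
      proof -
        have "(\<Sum>k\<in>S. M j k * y k) = (\<Sum>k\<in>S. M j k * x k) + h * (\<Sum>k\<in>S. M j k * (if k = i then 1 else 0))"
          unfolding y_def by (simp only: distrib_left sum.distrib sum_distrib_left mult.left_commute)
        then show ?thesis by (simp only: d1)
      qed
      have "quad_form S M y = (\<Sum>j\<in>S. x j * ((\<Sum>k\<in>S. M j k * x k) + h * M j i))
          + h * (\<Sum>j\<in>S. ((\<Sum>k\<in>S. M j k * x k) + h * M j i) * (if j = i then 1 else 0))"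
        unfolding quad_form_eq_sum My
        unfolding y_def sum_distrib_left sum.distrib[symmetric]
        by (intro sum.cong refl) (simp add: algebra_simps)
      also have "\<dots> = ?k + h * (\<Sum>j\<in>S. M i j * x j) + h * ((\<Sum>k\<in>S. M i k * x k) + h * M i i)"
      proof -
        have "(\<Sum>j\<in>S. x j * (h * M j i)) = h * (\<Sum>j\<in>S. M i j * x j)"
          unfolding sum_distrib_left
        proof (rule sum.cong[OF refl])
          fix j
          have "M j i = M i j" by (rule sym)
          then show "x j * (h * M j i) = h * (M i j * x j)" by simp
        qed
        then show ?thesis
          unfolding d1 quad_form_eq_sum by (simp only: distrib_left sum.distrib)
      qed
      finally have q: "quad_form S M y = ?k + 2 * h * (\<Sum>j\<in>S. M i j * x j) + h\<^sup>2 * M i i"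
        by (simp add: algebra_simps power2_eq_square)
      have "(\<Sum>j\<in>S. (y j)\<^sup>2) = (\<Sum>j\<in>S. (x j)\<^sup>2 + (2 * h * x j + h\<^sup>2) * (if j = i then 1 else 0))"
        by (intro sum.cong refl) (simp add: y_def power2_eq_square algebra_simps)
      also have "\<dots> = 1 + 2 * h * x i + h\<^sup>2"
        by (simp only: sum.distrib d1 x1 add.assoc)
      finally have "quad_form S M y \<le> ?k * (1 + 2 * h * x i + h\<^sup>2)"
        using x2[of y] by simp
      then show ?thesis unfolding q c_def by (simp add: algebra_simps)
    qed
    have "c = 0"
    proof (rule ccontr)
      assume c: "c \<noteq> 0"
      \<comment> \<open>With \<open>m\<close> above \<open>|M i i - k|\<close>, \<open>k\<close> the
        maximum, the step \<open>h = c / m\<close> is short enough for the first-order gain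
        \<open>2 c^2 / m\<close> to exceed the second-order loss, against maximality.\<close>
      define m where "m = \<bar>M i i - ?k\<bar> + 1"
      have m: "0 < m" "- m < M i i - ?k" by (auto simp: m_def)
      have "2 * (c / m) * c + (c / m)\<^sup>2 * (M i i - ?k) > 2 * (c / m) * c + (c / m)\<^sup>2 * (- 2 * m)"
        using m c by (intro add_strict_left_mono mult_strict_left_mono) auto
      moreover have "2 * (c / m) * c + (c / m)\<^sup>2 * (- 2 * m) = 0"
        using m by (simp add: power2_eq_square field_simps)
      ultimately show False using key[of "c / m"] by linarith
    qed
    then show ?thesis by (simp add: c_def)
  qed
  have "\<exists>i\<in>S. x i \<noteq> 0"
  proof (rule ccontr)
    assume "\<not> ?thesis"
    then have "(\<Sum>i\<in>S. (x i)\<^sup>2) = 0" by simp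
    with x1 show False by simp
  qed
  then have "is_eigenvalue_on S M ?k"
    using ev by (auto simp: is_eigenvalue_on_def)
  then have "?k \<le> lambda_max S M"
    unfolding lambda_max_def using finite_eigenvalues_on[OF S sym] by (intro Max_ge) auto
  then have "?k * (\<Sum>i\<in>S. (y i)\<^sup>2) \<le> lambda_max S M * (\<Sum>i\<in>S. (y i)\<^sup>2)"
    by (intro mult_right_mono sum_nonneg) auto
  with x2[of y] show ?thesis by linarith
qed

section \<open>Risk bounds\<close>

lemma gram_sym: "gram d A i j = gram d A j i"
  by (simp add: gram_def mult.commute)

lemma quad_form_support:
  "quad_form {..<d} M \<theta> = quad_form {i. i < d \<and> \<theta> i \<noteq> 0} M \<theta>"
proof -
  have "(\<Sum>j<d. M i j * \<theta> j) = (\<Sum>j\<in>{i. i < d \<and> \<theta> i \<noteq> 0}. M i j * \<theta> j)" for i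
    by (rule sum.mono_neutral_right) auto
  then show ?thesis
    unfolding quad_form_eq_sum by (simp only:) (rule sum.mono_neutral_right, auto)
qed

lemma sqnorm_support: "sqnorm d \<theta> = (\<Sum>i\<in>{i. i < d \<and> \<theta> i \<noteq> 0}. (\<theta> i)\<^sup>2)"
  unfolding sqnorm_def by (rule sum.mono_neutral_right) auto

lemma sqnorm_nonneg: "0 \<le> sqnorm d \<theta>"
  by (simp add: sqnorm_def sum_nonneg)

text \<open>Cauchy-Schwarz in every column of \<open>A\<close>, restricted to the support, bounds
  the form by the squared norm times the trace of the support block, which is at most
  \<open>s\<close> by the variance bound.\<close>

lemma quad_form_gram_le_sparsity:
  assumes "l0 d \<theta> \<le> s" and diag: "\<And>i. i < d \<Longrightarrow> gram d A i i \<le> 1"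
  shows "quad_form {..<d} (gram d A) \<theta> \<le> real s * sqnorm d \<theta>"
proof -
  let ?S = "{i. i < d \<and> \<theta> i \<noteq> 0}"
  have "quad_form {..<d} (gram d A) \<theta> = (\<Sum>k<d. (\<Sum>i\<in>?S. \<theta> i * A i k)\<^sup>2)"
  proof -
    have "(\<Sum>i<d. \<theta> i * A i k) = (\<Sum>i\<in>?S. \<theta> i * A i k)" for k
      by (rule sum.mono_neutral_right) auto
    then show ?thesis unfolding sum_power2_gram[symmetric] by simp
  qed
  also have "\<dots> \<le> (\<Sum>k<d. sqnorm d \<theta> * (\<Sum>i\<in>?S. (A i k)\<^sup>2))"
    unfolding sqnorm_support by (intro sum_mono Cauchy_Schwarz_ineq_sum)
  also have "\<dots> = sqnorm d \<theta> * (\<Sum>i\<in>?S. gram d A i i)"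
    unfolding gram_diag sum_distrib_left[symmetric] by (subst sum.swap) (rule refl)
  also have "\<dots> \<le> sqnorm d \<theta> * real s"
  proof (intro mult_left_mono sqnorm_nonneg)
    have "(\<Sum>i\<in>?S. gram d A i i) \<le> (\<Sum>i\<in>?S. 1)" using diag by (intro sum_mono) auto
    then show "(\<Sum>i\<in>?S. gram d A i i) \<le> real s" using assms(1) by (simp add: l0_def)
  qed
  finally show ?thesis by (simp add: mult.commute)
qed

lemma quad_form_le_frob: "quad_form {..<d} M \<theta> \<le> frob d M * sqnorm d \<theta>"
proof (rule power2_le_imp_le)
  have "(quad_form {..<d} M \<theta>)\<^sup>2 \<le> (\<Sum>i<d. (\<theta> i)\<^sup>2) * (\<Sum>i<d. (\<Sum>j<d. M i j * \<theta> j)\<^sup>2)"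
    unfolding quad_form_eq_sum by (rule Cauchy_Schwarz_ineq_sum)
  also have "\<dots> \<le> (\<Sum>i<d. (\<theta> i)\<^sup>2) * (\<Sum>i<d. (\<Sum>j<d. (M i j)\<^sup>2) * (\<Sum>j<d. (\<theta> j)\<^sup>2))"
    by (intro mult_left_mono sum_mono Cauchy_Schwarz_ineq_sum sum_nonneg) auto
  also have "\<dots> = (frob d M * sqnorm d \<theta>)\<^sup>2"
    by (simp add: power_mult_distrib frob_sq sqnorm_def sum_distrib_right[symmetric] power2_eq_square[of "sum _ _"])
  finally show "(quad_form {..<d} M \<theta>)\<^sup>2 \<le> (frob d M * sqnorm d \<theta>)\<^sup>2" .
  show "0 \<le> frob d M * sqnorm d \<theta>" by (simp add: frob_nonneg sqnorm_nonneg)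
qed

lemma psi_nonneg: "0 \<le> psi d s M"
  by (simp add: psi_def frob_nonneg)

text \<open>In the sparse regime \<open>s\<close> is at most twice the rate, in the dense regime the
  rate is the Frobenius norm; the matching bound on the form is used in each.\<close>

lemma quad_form_gram_le_psi:
  assumes "1 \<le> s" "l0 d \<theta> \<le> s" and "\<And>i. i < d \<Longrightarrow> gram d A i i \<le> 1"
  shows "quad_form {..<d} (gram d A) \<theta> \<le> 2 * psi d s (gram d A) * sqnorm d \<theta>"
proof (cases "real s \<le> frob d (gram d A)")
  case True
  have "real s * (1 / 2) \<le> psi d s (gram d A)"
    unfolding psi_def using True ln_ratio_ge_half[OF assms(1) True]
    by (simp only: if_True) (intro mult_left_mono, auto)
  then have "real s * sqnorm d \<theta> \<le> 2 * psi d s (gram d A) * sqnorm d \<theta>"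
    by (intro mult_right_mono sqnorm_nonneg) simp
  then show ?thesis using quad_form_gram_le_sparsity[OF assms(2,3)] by linarith
next
  case False
  then have "frob d (gram d A) * sqnorm d \<theta> \<le> 2 * psi d s (gram d A) * sqnorm d \<theta>"
    by (intro mult_right_mono sqnorm_nonneg) (simp add: psi_def frob_nonneg)
  then show ?thesis using quad_form_le_frob[of d "gram d A" \<theta>] by linarith
qed

text \<open>Both regimes under one absolute constant. The quadratic form is kept in the bound, since
  the three risk estimates replace it by different quantities.\<close>

lemma Qhat_dominated:
  "\<exists>C>0. \<forall>d s \<sigma> \<theta> A. 1 \<le> s \<longrightarrow> 0 < \<sigma> \<longrightarrow> l0 d \<theta> \<le> s \<longrightarrow> (\<forall>i<d. gram d A i i \<le> 1) \<longrightarrow>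
    (\<exists>B. integrable (std_gauss_vec d) B \<and>
    (\<forall>z. (Qhat d s \<sigma> (gram d A) (\<lambda>i. \<theta> i + \<sigma> * (\<Sum>k<d. A i k * z k)) - sqnorm d \<theta>)\<^sup>2 \<le> B z) \<and>
    (\<integral>z. B z \<partial>std_gauss_vec d) \<le> C * (\<sigma>\<^sup>2 * quad_form {..<d} (gram d A) \<theta> + \<sigma> ^ 4 * (psi d s (gram d A))\<^sup>2))"
proof -
  let ?J = gauss_exp_moment
  define c where "c = 600 * ?J + 486 * (tail_const + 1)\<^sup>2 + 460800 * ?J\<^sup>2 * tail_const\<^sup>2"
  define C where "C = 60 * ?J + 30000 * ?J\<^sup>2 + c"
  have J: "0 < ?J" using gauss_exp_moment_ge_1 by simp
  have c: "0 \<le> c" using J by (simp add: c_def)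
  have C: "0 < C" "40 * ?J \<le> C" "60 * ?J \<le> C" "30000 * ?J\<^sup>2 \<le> C" "c \<le> C"
    using J c by (auto simp: C_def add_pos_nonneg add_nonneg_nonneg)
  have comb: "a * x + b * y \<le> C * (x + y)" if "a \<le> C" "b \<le> C" "0 \<le> x" "0 \<le> y" for a b x y :: real
    using mult_right_mono[OF that(1,3)] mult_right_mono[OF that(2,4)] by (simp add: distrib_left)
  show ?thesis
  proof (intro exI[of _ C] conjI allI impI C(1))
    fix d s :: nat and \<sigma> :: real and \<theta> :: "nat \<Rightarrow> real" and A :: "nat \<Rightarrow> nat \<Rightarrow> real"
    assume *: "1 \<le> s" "0 < \<sigma>" "l0 d \<theta> \<le> s" "\<forall>i<d. gram d A i i \<le> 1"
    let ?x = "\<sigma>\<^sup>2 * quad_form {..<d} (gram d A) \<theta>" and ?y = "\<sigma> ^ 4 * (psi d s (gram d A))\<^sup>2"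
    have xy: "0 \<le> ?x" "0 \<le> ?y" by (simp_all add: quad_form_gram_nonneg)
    show "\<exists>B. integrable (std_gauss_vec d) B \<and>
      (\<forall>z. (Qhat d s \<sigma> (gram d A) (\<lambda>i. \<theta> i + \<sigma> * (\<Sum>k<d. A i k * z k)) - sqnorm d \<theta>)\<^sup>2 \<le> B z) \<and>
      (\<integral>z. B z \<partial>std_gauss_vec d) \<le> C * (?x + ?y)"
    proof (cases "real s \<le> frob d (gram d A)")
      case True
      show ?thesis
        using Qhat_dominated_sparse[OF *(1) True *(2,3), folded c_def] *(4) comb[OF C(3,5) xy]
        by (meson order_trans)
    next
      case False
      then have "frob d (gram d A) < real s" by simp
      from Qhat_dominated_dense[OF this, of \<sigma> \<theta>] comb[OF C(2,4) xy]
      show ?thesis by (meson order_trans)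
    qed
  qed
qed

text \<open>Domination alone suffices: a non-integrable function has Bochner integral 0, and the
  integral of \<open>B\<close> is nonnegative because \<open>B\<close> dominates a nonnegative
  function.\<close>

lemma gauss_expect_le:
  assumes "integrable (std_gauss_vec d) B"
    and "\<And>z. 0 \<le> f (\<lambda>i. \<theta> i + \<sigma> * (\<Sum>k<d. A i k * z k))"
    and "\<And>z. f (\<lambda>i. \<theta> i + \<sigma> * (\<Sum>k<d. A i k * z k)) \<le> B z"
  shows "gauss_expect d \<theta> \<sigma> A f \<le> (\<integral>z. B z \<partial>std_gauss_vec d)"
  unfolding gauss_expect_def
  by (rule integral_mono'[OF assms(1)]) (auto intro: assms order_trans[OF assms(2,3)])

section \<open>From the quadratic functional to the norm\<close>

lemma
  fixes x q :: real
  assumes q: "0 \<le> q"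
  shows sqrt_abs_diff_sq_le: "(sqrt \<bar>x\<bar> - sqrt q)\<^sup>2 \<le> \<bar>x - q\<bar>"
    and sqrt_abs_diff_sq_mult_le: "(sqrt \<bar>x\<bar> - sqrt q)\<^sup>2 * q \<le> (x - q)\<^sup>2"
proof -
  \<comment> \<open>In these terms \<open>||x| - q| = |a - b| (a + b)\<close>; the first bound
    follows from \<open>|a - b| <= a + b\<close>, the second from \<open>b <= a + b\<close>.\<close>
  define a b where "a = sqrt \<bar>x\<bar>" and "b = sqrt q"
  have ab: "0 \<le> a" "0 \<le> b" "a\<^sup>2 = \<bar>x\<bar>" "b\<^sup>2 = q" using q by (auto simp: a_def b_def)
  have fac: "\<bar>\<bar>x\<bar> - q\<bar> = \<bar>a - b\<bar> * (a + b)"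
  proof -
    have "\<bar>x\<bar> - q = (a - b) * (a + b)" unfolding ab(3,4)[symmetric] by (simp add: power2_eq_square algebra_simps)
    then show ?thesis using ab by (simp add: abs_mult)
  qed
  have le: "\<bar>\<bar>x\<bar> - q\<bar> \<le> \<bar>x - q\<bar>" using q by simp
  have "(a - b)\<^sup>2 = \<bar>a - b\<bar> * \<bar>a - b\<bar>" by (simp add: power2_eq_square)
  also have "\<dots> \<le> \<bar>a - b\<bar> * (a + b)" using ab by (intro mult_left_mono) auto
  finally show "(sqrt \<bar>x\<bar> - sqrt q)\<^sup>2 \<le> \<bar>x - q\<bar>" using fac le by (simp add: a_def b_def)
  have "(a - b)\<^sup>2 * q \<le> (a - b)\<^sup>2 * (a + b)\<^sup>2"
    unfolding ab(4)[symmetric] using ab by (intro mult_left_mono power_mono) auto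
  also have "\<dots> = \<bar>\<bar>x\<bar> - q\<bar>\<^sup>2" unfolding fac by (simp add: power_mult_distrib)
  also have "\<dots> \<le> \<bar>x - q\<bar>\<^sup>2" using le by (intro power_mono) auto
  finally show "(sqrt \<bar>x\<bar> - sqrt q)\<^sup>2 * q \<le> (x - q)\<^sup>2" by (simp add: a_def b_def)
qed

text \<open>Arithmetic-geometric mean with a free scale, to bound a first absolute moment by a
  second moment.\<close>

lemma abs_le_square_div_add:
  fixes x m :: real
  assumes "0 < m"
  shows "\<bar>x\<bar> \<le> (x\<^sup>2 / m + m) / 2"
proof -
  have "0 \<le> (\<bar>x\<bar> - m)\<^sup>2" by simp
  then have "2 * \<bar>x\<bar> * m \<le> x\<^sup>2 + m\<^sup>2" by (simp add: power2_diff)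
  then show ?thesis using assms by (simp add: field_simps power2_eq_square)
qed

text \<open>With \<open>m = \<sigma>^2 \<psi>\<close> and \<open>q\<close> the squared norm, the
  integral of \<open>B\<close> is at most \<open>C (2 m q + m^2)\<close>. For \<open>q < m\<close>
  the comparison with \<open>|Q - q|\<close> is used at scale \<open>m\<close>; for positive
  \<open>q >= m\<close> the comparison with \<open>(Q - q)^2 / q\<close>, where
  \<open>m^2 <= m q\<close> gives \<open>3 C m\<close>.\<close>

lemma Nhat_risk_le:
  fixes \<theta> :: "nat \<Rightarrow> real"
  assumes C: "0 \<le> C" and \<psi>: "0 \<le> \<psi>" and \<sigma>: "0 < \<sigma>"
    and B: "integrable (std_gauss_vec d) B"
      "\<And>z. (Qhat d s \<sigma> M (\<lambda>i. \<theta> i + \<sigma> * (\<Sum>k<d. A i k * z k)) - sqnorm d \<theta>)\<^sup>2 \<le> B z"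
    and BE: "(\<integral>z. B z \<partial>std_gauss_vec d) \<le> C * (\<sigma>\<^sup>2 * V + \<sigma> ^ 4 * \<psi>\<^sup>2)"
    and V: "V \<le> 2 * \<psi> * sqnorm d \<theta>"
  shows "gauss_expect d \<theta> \<sigma> A (\<lambda>Y. (Nhat d s \<sigma> M Y - sqrt (sqnorm d \<theta>))\<^sup>2) \<le> (3 * C + 1) * \<sigma>\<^sup>2 * \<psi>"
    (is "?E \<le> _")
proof -
  let ?P = "std_gauss_vec d" and ?Y = "\<lambda>z i. \<theta> i + \<sigma> * (\<Sum>k<d. A i k * z k)"
  define q where "q = sqnorm d \<theta>"
  define m where "m = \<sigma>\<^sup>2 * \<psi>"
  have q: "0 \<le> q" by (simp add: q_def sqnorm_nonneg)
  have m: "0 \<le> m" using \<psi> by (simp add: m_def)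
  have prob: "prob_space ?P"
    unfolding std_gauss_vec_def by (rule prob_space_PiM) (rule prob_space_std_gauss)
  then interpret prob_space ?P .
  have BE': "(\<integral>z. B z \<partial>?P) \<le> C * (2 * m * q + m\<^sup>2)"
  proof -
    have "\<sigma>\<^sup>2 * V \<le> \<sigma>\<^sup>2 * (2 * \<psi> * q)" using V by (intro mult_left_mono) (auto simp: q_def)
    then have "\<sigma>\<^sup>2 * V + \<sigma> ^ 4 * \<psi>\<^sup>2 \<le> 2 * m * q + m\<^sup>2"
      by (simp add: m_def power_mult_distrib mult_ac)
    then have "C * (\<sigma>\<^sup>2 * V + \<sigma> ^ 4 * \<psi>\<^sup>2) \<le> C * (2 * m * q + m\<^sup>2)"
      using C by (intro mult_left_mono)
    with BE show ?thesis by linarith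
  qed
  have any: "?E \<le> ((\<integral>z. B z \<partial>?P) / h + h) / 2" if h: "0 < h" for h
  proof -
    have i: "integrable ?P (\<lambda>z. (B z / h + h) / 2)" using B(1) by simp
    have "?E \<le> (\<integral>z. (B z / h + h) / 2 \<partial>?P)"
    proof (rule gauss_expect_le[OF i])
      fix z
      let ?Q = "Qhat d s \<sigma> M (?Y z)"
      have "(Nhat d s \<sigma> M (?Y z) - sqrt (sqnorm d \<theta>))\<^sup>2 \<le> \<bar>?Q - q\<bar>"
        unfolding Nhat_def q_def[symmetric] by (rule sqrt_abs_diff_sq_le[OF q])
      also have "\<dots> \<le> ((?Q - q)\<^sup>2 / h + h) / 2" by (rule abs_le_square_div_add[OF h])
      also have "\<dots> \<le> (B z / h + h) / 2"
        using B(2)[of z] h by (simp add: divide_right_mono q_def)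
      finally show "(Nhat d s \<sigma> M (?Y z) - sqrt (sqnorm d \<theta>))\<^sup>2 \<le> (B z / h + h) / 2" .
    qed simp
    also have "\<dots> = ((\<integral>z. B z \<partial>?P) / h + h) / 2"
      using B(1) by (simp add: prob_space)
    finally show ?thesis .
  qed
  have "?E \<le> (3 * C + 1) * m"
  proof (cases "q < m")
    case True
    then have mpos: "0 < m" using q by simp
    have "C * (2 * m * q + m\<^sup>2) \<le> C * (2 * m * m + m\<^sup>2)"
      using C True mpos by (intro mult_left_mono add_mono) auto
    with BE' have "(\<integral>z. B z \<partial>?P) \<le> 3 * C * m * m" by (simp add: power2_eq_square)
    then have "(\<integral>z. B z \<partial>?P) / m \<le> 3 * C * m" using mpos by (simp add: divide_le_eq)
    moreover have "0 \<le> C * m" using C m by simp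
    ultimately show ?thesis using any[OF mpos] m by (simp add: algebra_simps)
  next
    case mq: False
    show ?thesis
    proof (cases "q = 0")
      case True
      \<comment> \<open>Neither scale is available for division here, but the integral of
        \<open>B\<close> is at most 0, so every \<open>h > 0\<close> bounds the risk.\<close>
      then have m0: "m = 0" using mq m by simp
      have "?E \<le> 0 + h" if "0 < h" for h
      proof -
        have "(\<integral>z. B z \<partial>?P) / h \<le> 0" using BE' that by (simp add: m0 divide_le_0_iff)
        then show ?thesis using any[OF that] that by simp
      qed
      then have "?E \<le> 0" by (rule field_le_epsilon)
      then show ?thesis using m0 by simp
    next
      case False
      then have qpos: "0 < q" using q by simp
      have i: "integrable ?P (\<lambda>z. B z / q)" using B(1) by simp
      have "?E \<le> (\<integral>z. B z / q \<partial>?P)"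
      proof (rule gauss_expect_le[OF i])
        fix z
        let ?Q = "Qhat d s \<sigma> M (?Y z)"
        have "(Nhat d s \<sigma> M (?Y z) - sqrt (sqnorm d \<theta>))\<^sup>2 * q \<le> (?Q - q)\<^sup>2"
          unfolding Nhat_def q_def[symmetric] by (rule sqrt_abs_diff_sq_mult_le[OF q])
        also have "\<dots> \<le> B z" using B(2)[of z] by (simp add: q_def)
        finally show "(Nhat d s \<sigma> M (?Y z) - sqrt (sqnorm d \<theta>))\<^sup>2 \<le> B z / q"
          using qpos by (simp add: le_divide_eq)
      qed simp
      also have "\<dots> = (\<integral>z. B z \<partial>?P) / q" by simp
      also have "\<dots> \<le> 3 * C * m"
      proof -
        have "C * (2 * m * q + m\<^sup>2) \<le> C * (2 * m * q + m * q)"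
          using C m mq by (intro mult_left_mono add_mono) (auto simp: power2_eq_square intro: mult_left_mono)
        with BE' have "(\<integral>z. B z \<partial>?P) \<le> 3 * C * m * q" by (simp add: algebra_simps)
        then show ?thesis using qpos by (simp add: divide_le_eq)
      qed
      also have "\<dots> \<le> (3 * C + 1) * m" using m by (simp add: algebra_simps)
      finally show ?thesis .
    qed
  qed
  then show ?thesis by (simp add: m_def mult_ac)
qed

section \<open>Assembly of the three risk bounds\<close>

theorem theorem1:
  shows "\<exists>C>0.
    (\<forall>d s \<sigma> \<theta> A \<Sigma>. 1 \<le> d \<longrightarrow> 1 \<le> s \<longrightarrow> s \<le> d \<longrightarrow> \<sigma> > 0 \<longrightarrow>
       l0 d \<theta> \<le> s \<longrightarrow> \<Sigma> = gram d A \<longrightarrow> (\<forall>i<d. \<Sigma> i i \<le> 1) \<longrightarrow>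
       gauss_expect d \<theta> \<sigma> A (\<lambda>Y. (Qhat d s \<sigma> \<Sigma> Y - sqnorm d \<theta>)\<^sup>2)
         \<le> C * (\<sigma>\<^sup>2 * sqnorm d \<theta> * lambda_max {i. i < d \<and> \<theta> i \<noteq> 0} \<Sigma>
                 + \<sigma>^4 * (psi d s \<Sigma>)\<^sup>2)) \<and>
    (\<forall>d s \<sigma> r \<theta> A \<Sigma>. 1 \<le> d \<longrightarrow> 1 \<le> s \<longrightarrow> s \<le> d \<longrightarrow> \<sigma> > 0 \<longrightarrow> r > 0 \<longrightarrow>
       l0 d \<theta> \<le> s \<longrightarrow> sqrt (sqnorm d \<theta>) \<le> r \<longrightarrow>
       \<Sigma> = gram d A \<longrightarrow> (\<forall>i<d. \<Sigma> i i \<le> 1) \<longrightarrow>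
       gauss_expect d \<theta> \<sigma> A (\<lambda>Y. (Qhat d s \<sigma> \<Sigma> Y - sqnorm d \<theta>)\<^sup>2)
         \<le> C * (\<sigma>\<^sup>2 * r\<^sup>2 * psibar d s \<Sigma> + \<sigma>^4 * (psi d s \<Sigma>)\<^sup>2)) \<and>
    (\<forall>d s \<sigma> \<theta> A \<Sigma>. 1 \<le> d \<longrightarrow> 1 \<le> s \<longrightarrow> s \<le> d \<longrightarrow> \<sigma> > 0 \<longrightarrow>
       l0 d \<theta> \<le> s \<longrightarrow> \<Sigma> = gram d A \<longrightarrow> (\<forall>i<d. \<Sigma> i i \<le> 1) \<longrightarrow>
       gauss_expect d \<theta> \<sigma> A (\<lambda>Y. (Nhat d s \<sigma> \<Sigma> Y - sqrt (sqnorm d \<theta>))\<^sup>2)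
         \<le> C * \<sigma>\<^sup>2 * psi d s \<Sigma>)"
proof -
  obtain C where C: "0 < C" and dom: "\<forall>d s \<sigma> \<theta> A. 1 \<le> s \<longrightarrow> 0 < \<sigma> \<longrightarrow> l0 d \<theta> \<le> s \<longrightarrow> (\<forall>i<d. gram d A i i \<le> 1) \<longrightarrow>
    (\<exists>B. integrable (std_gauss_vec d) B \<and>
    (\<forall>z. (Qhat d s \<sigma> (gram d A) (\<lambda>i. \<theta> i + \<sigma> * (\<Sum>k<d. A i k * z k)) - sqnorm d \<theta>)\<^sup>2 \<le> B z) \<and>
    (\<integral>z. B z \<partial>std_gauss_vec d) \<le> C * (\<sigma>\<^sup>2 * quad_form {..<d} (gram d A) \<theta> + \<sigma> ^ 4 * (psi d s (gram d A))\<^sup>2))"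
    using Qhat_dominated by (elim exE conjE)
  note dominated = dom[THEN spec, THEN spec, THEN spec, THEN spec, THEN spec, THEN mp, THEN mp, THEN mp, THEN mp]
  have Qrisk: "gauss_expect d \<theta> \<sigma> A (\<lambda>Y. (Qhat d s \<sigma> (gram d A) Y - sqnorm d \<theta>)\<^sup>2)
      \<le> (3 * C + 1) * (X + \<sigma> ^ 4 * (psi d s (gram d A))\<^sup>2)"
    if *: "1 \<le> s" "0 < \<sigma>" "l0 d \<theta> \<le> s" "\<forall>i<d. gram d A i i \<le> 1"
      and X: "\<sigma>\<^sup>2 * quad_form {..<d} (gram d A) \<theta> \<le> X" for d s \<sigma> \<theta> A X
  proof -
    obtain B where B: "integrable (std_gauss_vec d) B"
      "\<forall>z. (Qhat d s \<sigma> (gram d A) (\<lambda>i. \<theta> i + \<sigma> * (\<Sum>k<d. A i k * z k)) - sqnorm d \<theta>)\<^sup>2 \<le> B z"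
      "(\<integral>z. B z \<partial>std_gauss_vec d) \<le> C * (\<sigma>\<^sup>2 * quad_form {..<d} (gram d A) \<theta> + \<sigma> ^ 4 * (psi d s (gram d A))\<^sup>2)"
      using dominated[OF *(1-4)] by (elim exE conjE)
    have "gauss_expect d \<theta> \<sigma> A (\<lambda>Y. (Qhat d s \<sigma> (gram d A) Y - sqnorm d \<theta>)\<^sup>2) \<le> (\<integral>z. B z \<partial>std_gauss_vec d)"
      by (rule gauss_expect_le[OF B(1)]) (simp_all add: B(2)[rule_format])
    also note B(3)
    also have "C * (\<sigma>\<^sup>2 * quad_form {..<d} (gram d A) \<theta> + \<sigma> ^ 4 * (psi d s (gram d A))\<^sup>2)
        \<le> (3 * C + 1) * (X + \<sigma> ^ 4 * (psi d s (gram d A))\<^sup>2)"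
      using C X quad_form_gram_nonneg[of d A \<theta>] by (intro mult_mono add_mono) auto
    finally show ?thesis .
  qed
  show ?thesis
  \<comment> \<open>\<open>3 C + 1\<close> is the constant of the norm risk; the quadratic risks
    already hold with the smaller \<open>C\<close>.\<close>
  proof (rule exI[of _ "3 * C + 1"], intro conjI allI impI)
    show "0 < 3 * C + 1" using C by simp
  next
    fix d s :: nat and \<sigma> :: real and \<theta> :: "nat \<Rightarrow> real" and A \<Sigma> :: "nat \<Rightarrow> nat \<Rightarrow> real"
    assume "1 \<le> d" and *: "1 \<le> s" "s \<le> d" "\<sigma> > 0" "l0 d \<theta> \<le> s" "\<Sigma> = gram d A" "\<forall>i<d. \<Sigma> i i \<le> 1"
    let ?S = "{i. i < d \<and> \<theta> i \<noteq> 0}"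
    \<comment> \<open>The form only sees the support, so the Rayleigh bound applies to the support
      block.\<close>
    have "quad_form {..<d} \<Sigma> \<theta> \<le> lambda_max ?S \<Sigma> * sqnorm d \<theta>"
      unfolding quad_form_support sqnorm_support *(5)
      by (rule quad_form_le_lambda_max) (auto intro: gram_sym)
    then have "\<sigma>\<^sup>2 * quad_form {..<d} \<Sigma> \<theta> \<le> \<sigma>\<^sup>2 * (lambda_max ?S \<Sigma> * sqnorm d \<theta>)"
      by (intro mult_left_mono) auto
    then have X: "\<sigma>\<^sup>2 * quad_form {..<d} \<Sigma> \<theta> \<le> \<sigma>\<^sup>2 * sqnorm d \<theta> * lambda_max ?S \<Sigma>"
      by (simp add: mult_ac)
    show "gauss_expect d \<theta> \<sigma> A (\<lambda>Y. (Qhat d s \<sigma> \<Sigma> Y - sqnorm d \<theta>)\<^sup>2)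
      \<le> (3 * C + 1) * (\<sigma>\<^sup>2 * sqnorm d \<theta> * lambda_max ?S \<Sigma> + \<sigma>^4 * (psi d s \<Sigma>)\<^sup>2)"
      using Qrisk[OF *(1,3,4) *(6)[unfolded *(5)] X[unfolded *(5)]] unfolding *(5) .
  next
    fix d s :: nat and \<sigma> r :: real and \<theta> :: "nat \<Rightarrow> real" and A \<Sigma> :: "nat \<Rightarrow> nat \<Rightarrow> real"
    assume d: "1 \<le> d" and *: "1 \<le> s" "s \<le> d" "\<sigma> > 0" "l0 d \<theta> \<le> s" "\<Sigma> = gram d A" "\<forall>i<d. \<Sigma> i i \<le> 1"
      and r: "r > 0" "sqrt (sqnorm d \<theta>) \<le> r"
    have lam: "quad_form {..<d} \<Sigma> y \<le> lambda_max {..<d} \<Sigma> * sqnorm d y" for y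
      unfolding sqnorm_def *(5) by (rule quad_form_le_lambda_max) (auto intro: gram_sym)
    \<comment> \<open>Allows the squared norm to be enlarged to \<open>r^2\<close>. The first
      coordinate vector, available because \<open>1 \<le> d\<close>, bounds the eigenvalue below by
      a nonnegative value of the form.\<close>
    have "0 \<le> lambda_max {..<d} \<Sigma>"
    proof -
      let ?e = "\<lambda>i. if i = 0 then 1 else 0 :: real"
      have "sqnorm d ?e = (\<Sum>i<d. if i = 0 then 1 else 0)"
        unfolding sqnorm_def by (intro sum.cong) auto
      then have "sqnorm d ?e = 1" using d by simp
      moreover have "0 \<le> quad_form {..<d} \<Sigma> ?e"
        unfolding *(5) by (rule quad_form_gram_nonneg)
      ultimately show ?thesis using lam[of ?e] by simp
    qed
    then have pb: "0 \<le> psibar d s \<Sigma>" by (simp add: psibar_def)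
    have r2: "sqnorm d \<theta> \<le> r\<^sup>2"
      using r power_mono[OF r(2), of 2] by (simp add: sqnorm_nonneg)
    \<comment> \<open>Whichever term attains the minimum in \<open>psibar\<close> supplies the bound
      on the form.\<close>
    have "quad_form {..<d} \<Sigma> \<theta> \<le> psibar d s \<Sigma> * sqnorm d \<theta>"
    proof (cases "lambda_max {..<d} \<Sigma> \<le> real s")
      case True
      then show ?thesis using lam[of \<theta>] by (simp add: psibar_def)
    next
      case False
      then show ?thesis
        using quad_form_gram_le_sparsity[OF *(4), of A] *(5,6) by (simp add: psibar_def)
    qed
    also have "\<dots> \<le> psibar d s \<Sigma> * r\<^sup>2" using r2 pb by (rule mult_left_mono)
    finally have "\<sigma>\<^sup>2 * quad_form {..<d} \<Sigma> \<theta> \<le> \<sigma>\<^sup>2 * (psibar d s \<Sigma> * r\<^sup>2)"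
      by (intro mult_left_mono) auto
    then have X: "\<sigma>\<^sup>2 * quad_form {..<d} \<Sigma> \<theta> \<le> \<sigma>\<^sup>2 * r\<^sup>2 * psibar d s \<Sigma>"
      by (simp add: mult_ac)
    show "gauss_expect d \<theta> \<sigma> A (\<lambda>Y. (Qhat d s \<sigma> \<Sigma> Y - sqnorm d \<theta>)\<^sup>2)
      \<le> (3 * C + 1) * (\<sigma>\<^sup>2 * r\<^sup>2 * psibar d s \<Sigma> + \<sigma>^4 * (psi d s \<Sigma>)\<^sup>2)"
      using Qrisk[OF *(1,3,4) *(6)[unfolded *(5)] X[unfolded *(5)]] unfolding *(5) .
  next
    fix d s :: nat and \<sigma> :: real and \<theta> :: "nat \<Rightarrow> real" and A \<Sigma> :: "nat \<Rightarrow> nat \<Rightarrow> real"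
    assume "1 \<le> d" and *: "1 \<le> s" "s \<le> d" "\<sigma> > 0" "l0 d \<theta> \<le> s" "\<Sigma> = gram d A" "\<forall>i<d. \<Sigma> i i \<le> 1"
    obtain B where B: "integrable (std_gauss_vec d) B"
      "\<forall>z. (Qhat d s \<sigma> (gram d A) (\<lambda>i. \<theta> i + \<sigma> * (\<Sum>k<d. A i k * z k)) - sqnorm d \<theta>)\<^sup>2 \<le> B z"
      "(\<integral>z. B z \<partial>std_gauss_vec d) \<le> C * (\<sigma>\<^sup>2 * quad_form {..<d} (gram d A) \<theta> + \<sigma> ^ 4 * (psi d s (gram d A))\<^sup>2)"
      using dominated[OF *(1,3,4) *(6)[unfolded *(5)]] by (elim exE conjE)
    have V: "quad_form {..<d} (gram d A) \<theta> \<le> 2 * psi d s (gram d A) * sqnorm d \<theta>"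
      by (rule quad_form_gram_le_psi[OF *(1,4) *(6)[unfolded *(5), rule_format]])
    show "gauss_expect d \<theta> \<sigma> A (\<lambda>Y. (Nhat d s \<sigma> \<Sigma> Y - sqrt (sqnorm d \<theta>))\<^sup>2)
      \<le> (3 * C + 1) * \<sigma>\<^sup>2 * psi d s \<Sigma>"
      unfolding *(5) by (rule Nhat_risk_le[OF less_imp_le[OF C] psi_nonneg *(3) B(1) B(2)[rule_format] B(3) V])
  qed
qed

end
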